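(* Let $m>0$ and $g>0$, and let $V(q)=-\dfrac{m}{|q|}-g q_1^2-g\dfrac{q_2^2}{4}$ on $\mathbb{R}^2\setminus\{0\}$ (the potential of the frozen Hill's problem with centrifugal correction), which has two different critical values. Let the energy $-f$ ($f\in\mathbb{R}$) be strictly below the first critical value of $V$. Then, after Levi-Civita regularization of the energy hypersurface $\{H=-f\}$ of $H(p,q)=\frac{|p|^2}{2}+V(q)$, the corresponding bounded component of the regularized energy hypersurface $\{K=m\}$ bounds a concave toric domain.
   Context: The first critical value of $V$ is the lower one of its two critical values. Levi-Civita regularization: identify $\mathbb{R}^2\cong\mathbb{C}$. The shifted Hamiltonian $H+f$ and its zero level are pulled back by the map $(z,w)\mapsto (q=z^2,\ p=\frac{w}{2\bar z})$ and multiplied by $|z|^2$ (a time reparametrization). With $z=z_1+iz_2$, $w=w_1+iw_2$, the energy level $\{H=-f\}$ becomes the level $\{K=m\}$ in $\mathbb{R}^4$ (extended smoothly over $z=0$), where $$K=\frac{|w|^2}{8}+f(z_1^2+z_2^2)-g(z_1^6+z_2^6)=K_1(z_1,w_1)+K_2(z_2,w_2),\qquad K_i=\frac{w_i^2}{8}+f z_i^2-g z_i^6 .$$ For energies below the first critical value, $\{H=-f\}$ has a component projecting to a bounded region of the configuration space, and correspondingly $\{K=m\}$ has a bounded closed component; the domain it bounds is the region around the origin enclosed by it. Action variables: for the values $a$ of $K_1$ and $b=m-a$ of $K_2$ taken on the bounded component, $0\le a\le m$, let $I_1(a)=\frac{1}{2\pi}\int_{\{K_1=a\}}w_1\,dz_1$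 and $I_2(b)=\frac{1}{2\pi}\int_{\{K_2=b\}}w_2\,dz_2$ be $\frac1{2\pi}$ times the areas enclosed by the closed curves around the origin in the $(z_1,w_1)$- and $(z_2,w_2)$-planes which are the levels of $K_1$ and $K_2$ within the bounded component (with $I_i(0)=0$). The moment map image of the bounded component is the curve $\{(I_1(a),I_2(m-a)):0\le a\le m\}$ in the quadrant $\{I_1\ge 0, I_2\ge 0\}$, connecting the two axes. The bounded component is said to bound a concave toric domain if this curve is the graph $I_2=\varphi(I_1)$ of a smooth non-increasing convex function $\varphi$, and a convex toric domain if it is the graph of a smooth non-increasing concave function. *)

theory Defs
  imports "HOL-Analysis.Analysis"
begin

text \<open>The plane of positions and the plane of momenta are both identified with the complex numbers;
  phase space points are pairs \<open>(q, p)\<close>, regularized phase space points are pairs \<open>(z, w)\<close>.\<close>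

definition hill_V :: "real \<Rightarrow> real \<Rightarrow> complex \<Rightarrow> real" where
  "hill_V m g q = - m / cmod q - g * (Re q)^2 - g * ((Im q)^2 / 4)"

definition critical_values :: "(complex \<Rightarrow> real) \<Rightarrow> real set" where
  "critical_values V = {V q | q. q \<noteq> 0 \<and> (V has_derivative (\<lambda>_. 0)) (at q)}"

text \<open>\<^const>\<open>Min\<close> is only meaningful when the set of critical values is finite and nonempty.\<close>

definition first_critical_value :: "(complex \<Rightarrow> real) \<Rightarrow> real" where
  "first_critical_value V = Min (critical_values V)"

definition hill_H :: "real \<Rightarrow> real \<Rightarrow> complex \<times> complex \<Rightarrow> real" where
  "hill_H m g = (\<lambda>(q, p). (cmod p)^2 / 2 + hill_V m g q)"

definition energy_hypersurface :: "real \<Rightarrow> real \<Rightarrow> real \<Rightarrow> (complex \<times> complex) set" where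
  "energy_hypersurface m g f = {(q, p). q \<noteq> 0 \<and> hill_H m g (q, p) = - f}"

definition levi_civita :: "complex \<times> complex \<Rightarrow> complex \<times> complex" where
  "levi_civita = (\<lambda>(z, w). (z^2, w / (2 * cnj z)))"

definition reg_K :: "real \<Rightarrow> real \<Rightarrow> complex \<times> complex \<Rightarrow> real" where
  "reg_K f g = (\<lambda>(z, w). (cmod w)^2 / 8 + f * ((Re z)^2 + (Im z)^2) - g * ((Re z)^6 + (Im z)^6))"

text \<open>The two summands of \<open>reg_K\<close> are the same function, in the planes \<open>(Re z, Re w)\<close> and
  \<open>(Im z, Im w)\<close>.\<close>

definition plane_K :: "real \<Rightarrow> real \<Rightarrow> real \<times> real \<Rightarrow> real" where
  "plane_K f g = (\<lambda>(x, y). y^2 / 8 + f * x^2 - g * x^6)"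

lemma reg_K_split:
  "reg_K f g (z, w) = plane_K f g (Re z, Re w) + plane_K f g (Im z, Im w)"
  by (simp add: reg_K_def plane_K_def cmod_power2 field_simps)

definition regularized_hypersurface :: "real \<Rightarrow> real \<Rightarrow> real \<Rightarrow> (complex \<times> complex) set" where
  "regularized_hypersurface m g f = {x. reg_K f g x = m}"

text \<open>The levels of the two summands within a subset \<open>C\<close> of the regularized phase space.\<close>

definition level1 :: "real \<Rightarrow> real \<Rightarrow> (complex \<times> complex) set \<Rightarrow> real \<Rightarrow> (real \<times> real) set" where
  "level1 f g C a = {(Re z, Re w) | z w. (z, w) \<in> C \<and> plane_K f g (Re z, Re w) = a}"

definition level2 :: "real \<Rightarrow> real \<Rightarrow> (complex \<times> complex) set \<Rightarrow> real \<Rightarrow> (real \<times> real) set" where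
  "level2 f g C b = {(Im z, Im w) | z w. (z, w) \<in> C \<and> plane_K f g (Im z, Im w) = b}"

text \<open>For a closed curve \<open>S\<close>, \<^term>\<open>inside S\<close> is the region it encloses. When \<open>S\<close> is a single point
  it is empty, so the action of a degenerate level is \<open>0\<close>.\<close>

definition action :: "(real \<times> real) set \<Rightarrow> real" where
  "action S = measure lebesgue (inside S) / (2 * pi)"

definition moment_curve :: "real \<Rightarrow> real \<Rightarrow> real \<Rightarrow> (complex \<times> complex) set \<Rightarrow> (real \<times> real) set" where
  "moment_curve m g f C =
     (\<lambda>a. (action (level1 f g C a), action (level2 f g C (m - a)))) ` {0..m}"

text \<open>Derivatives of all orders within \<open>S\<close>; at the endpoints of a nondegenerate compact interval
  they are one-sided.\<close>

definition smooth_within :: "real set \<Rightarrow> (real \<Rightarrow> real) \<Rightarrow> bool" where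
  "smooth_within S \<phi> \<longleftrightarrow>
     (\<exists>D :: nat \<Rightarrow> real \<Rightarrow> real. (\<forall>x\<in>S. D 0 x = \<phi> x) \<and>
        (\<forall>n. \<forall>x\<in>S. (D n has_real_derivative D (Suc n) x) (at x within S)))"

definition bounds_concave_toric_domain ::
    "real \<Rightarrow> real \<Rightarrow> real \<Rightarrow> (complex \<times> complex) set \<Rightarrow> bool" where
  "bounds_concave_toric_domain m g f C \<longleftrightarrow>
     (\<exists>A>0. \<exists>\<phi> :: real \<Rightarrow> real.
        moment_curve m g f C = {(x, \<phi> x) | x. x \<in> {0..A}} \<and>
        smooth_within {0..A} \<phi> \<and> antimono_on {0..A} \<phi> \<and> convex_on {0..A} \<phi>)"

end

theory Submission
  imports Defs
begin

text \<open>Put \<open>u x = f x - g x\<^sup>3\<close>, so that each of the two summands of \<open>K\<close> is \<open>y\<^sup>2 / 8 + u (x\<^sup>2)\<close>: both planes carry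
the same one-dimensional system. On \<open>x \<ge> 0\<close> the function \<open>u\<close> increases up to \<open>s = sqrt (f / (3 g))\<close> and
decreases afterwards. The lower critical value of \<open>V\<close> is attained at the distance \<open>\<rho>\<close> with
\<open>2 g \<rho>\<^sup>3 = m\<close>, where it equals \<open>- 3 g \<rho>\<^sup>2\<close>; an energy \<open>- f\<close> below it therefore gives \<open>\<rho> < s\<close> and
\<open>u \<rho> > m\<close>, and \<open>u\<close> takes the value \<open>m\<close> at some \<open>p < s\<close>
(\<open>hill_well_below_first_critical_value\<close>).

Topology. On \<open>{K = m}\<close> the box \<open>(Re z)\<^sup>2, (Im z)\<^sup>2 < s\<close> and the smaller closed box with \<open>p\<close> in place of \<open>s\<close>
cut out the same set, because inside the well both summands are nonnegative and hence at most \<open>m\<close>.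
This set is relatively open and closed. The substitution \<open>X\<^sup>2 = u (x\<^sup>2)\<close> in each plane turns it into a
round 3-sphere, so it is connected and a component; removing \<open>z = 0\<close> removes a circle from the sphere and
leaves it connected, and its Levi-Civita image is a component of the energy hypersurface by the same
argument. A point of \<open>{K = m}\<close> beyond the well can be moved to infinity within the level, so there is no
other bounded component (\<open>bounded_component_iff\<close>).

Actions. Let \<open>\<sigma>\<close> be the inverse of \<open>u\<close> on \<open>{0..p}\<close>. Slicing \<open>{y\<^sup>2 / 8 + u (x\<^sup>2) < a}\<close> horizontally and
substituting \<open>y = sqrt (8 a) sin t\<close> gives its area as \<open>2 sqrt 8 a\<close> times the integral of
\<open>cos\<^sup>2 t R (a cos\<^sup>2 t)\<close>, where \<open>R b = sqrt (\<sigma> b / b)\<close> equals \<open>1 / sqrt (f - g (\<sigma> b)\<^sup>2)\<close> and is thus smooth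
up to \<open>b = 0\<close> (\<open>area_between_levels\<close>). As \<open>u\<close> is concave, \<open>\<sigma>\<close> is convex and increasing, hence so is
\<open>R\<close>, and hence so is the action \<open>I\<close> as a function of the level. Convexity of \<open>I\<close> means that the period of
oscillation in the well does not decrease with the energy.

Concavity of the domain. The moment curve \<open>{(I a, I (m - a))}\<close> is the graph of
\<open>\<phi> x = I (m - I\<inverse> x)\<close>. The inverse of a convex increasing function is concave, so \<open>m - I\<inverse> x\<close> is convex
and decreasing, and so is \<open>\<phi>\<close>. Smoothness up to the endpoints follows because the slope of \<open>I\<close> is bounded
below by a positive constant.\<close>

section \<open>Functions with derivatives of all orders on an interval\<close>

text \<open>A class of functions closed under differentiation provides derivatives of all orders by iteration, with
no formula for the \<open>n\<close>-th one. The polynomial expressions in a set of generators form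
such a class as soon as the derivative of every generator is again such an expression.\<close>

inductive_set generated_algebra :: "('a \<Rightarrow> real) set \<Rightarrow> ('a \<Rightarrow> real) set" for G where
  generator: "F \<in> G \<Longrightarrow> F \<in> generated_algebra G"
| const: "(\<lambda>x. c) \<in> generated_algebra G"
| add: "F \<in> generated_algebra G \<Longrightarrow> H \<in> generated_algebra G
    \<Longrightarrow> (\<lambda>x. F x + H x) \<in> generated_algebra G"
| mult: "F \<in> generated_algebra G \<Longrightarrow> H \<in> generated_algebra G
    \<Longrightarrow> (\<lambda>x. F x * H x) \<in> generated_algebra G"

text \<open>The sum and product rules carry closure under differentiation from the generators to the whole
algebra. A choice function for the derivative is then iterated.\<close>

lemma smooth_within_generated_algebra:
  fixes G :: "(real \<Rightarrow> real) set"
  assumes G: "\<And>F. F \<in> G \<Longrightarrow>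
      \<exists>F'\<in>generated_algebra G. \<forall>x\<in>S. (F has_real_derivative F' x) (at x within S)"
    and F: "F \<in> generated_algebra G"
  shows "smooth_within S F"
proof -
  have "\<exists>F'\<in>generated_algebra G. \<forall>x\<in>S. (F has_real_derivative F' x) (at x within S)"
    if "F \<in> generated_algebra G" for F
    using that
  proof induction
    case (generator F)
    then show ?case by (rule G)
  next
    case (const c)
    show ?case
      by (rule bexI[OF _ generated_algebra.const[of 0]]) auto
  next
    case (add F H)
    then obtain F' H' where
      "F' \<in> generated_algebra G" "\<forall>x\<in>S. (F has_real_derivative F' x) (at x within S)"
      "H' \<in> generated_algebra G" "\<forall>x\<in>S. (H has_real_derivative H' x) (at x within S)"
      by blast
    then show ?case
      by (intro bexI[of _ "\<lambda>x. F' x + H' x"]) (auto intro: generated_algebra.add DERIV_add)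
  next
    case (mult F H)
    then obtain F' H' where
      "F' \<in> generated_algebra G" "\<forall>x\<in>S. (F has_real_derivative F' x) (at x within S)"
      "H' \<in> generated_algebra G" "\<forall>x\<in>S. (H has_real_derivative H' x) (at x within S)"
      by blast
    with mult.hyps show ?case
      by (intro bexI[of _ "\<lambda>x. F' x * H x + H' x * F x"])
         (auto intro: generated_algebra.intros DERIV_mult)
  qed
  then obtain d where d: "\<And>F. F \<in> generated_algebra G \<Longrightarrow> d F \<in> generated_algebra G"
      "\<And>F x. F \<in> generated_algebra G \<Longrightarrow> x \<in> S \<Longrightarrow> (F has_real_derivative d F x) (at x within S)"
    by metis
  have "(d ^^ n) F \<in> generated_algebra G" for n
    by (induction n) (auto intro: d F)
  then show ?thesis
    unfolding smooth_within_def using d by (intro exI[of _ "\<lambda>n. (d ^^ n) F"]) auto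
qed

lemma smooth_within_reflect:
  assumes "smooth_within {0..m} F"
  shows "smooth_within {0..m} (\<lambda>a. F (m - a))"
proof -
  obtain D where D: "\<And>x. x \<in> {0..m} \<Longrightarrow> D 0 x = F x"
    "\<And>n x. x \<in> {0..m} \<Longrightarrow> (D n has_real_derivative D (Suc n) x) (at x within {0..m})"
    using assms unfolding smooth_within_def by metis
  have "((\<lambda>a. (-1)^n * D n (m - a)) has_real_derivative (-1)^Suc n * D (Suc n) (m - x))
          (at x within {0..m})" if "x \<in> {0..m}" for n x
  proof -
    have "(\<lambda>a. m - a) ` {0..m} = {0..m}"
      by (auto simp: image_iff intro!: bexI[of _ "m - _"])
    then have outer: "(D n has_real_derivative D (Suc n) (m - x))
        (at (m - x) within (\<lambda>a. m - a) ` {0..m})"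
      using D(2)[of "m - x" n] that by auto
    have inner: "((\<lambda>a. m - a) has_real_derivative -1) (at x within {0..m})"
      by (auto intro!: derivative_eq_intros)
    have "((\<lambda>a. D n (m - a)) has_real_derivative D (Suc n) (m - x) * -1) (at x within {0..m})"
      using DERIV_image_chain[OF outer inner] unfolding o_def .
    from DERIV_cmult[OF this, of "(-1)^n"] show ?thesis
      by simp
  qed
  then show ?thesis
    unfolding smooth_within_def
    by (intro exI[of _ "\<lambda>n a. (-1)^n * D n (m - a)"]) (auto simp: D(1))
qed

text \<open>Difference quotients of \<open>J\<close> are reciprocals of difference quotients of \<open>h\<close> along \<open>J\<close>. Derivatives within
sets are used throughout, so that endpoints of intervals need no special treatment.\<close>

lemma has_real_derivative_inverse_within:
  fixes h J :: "real \<Rightarrow> real"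
  assumes der: "(h has_real_derivative d) (at (J y) within S)" and "d \<noteq> 0"
    and cont: "continuous (at y within T) J" and "y \<in> T"
    and JS: "\<And>z. z \<in> T \<Longrightarrow> J z \<in> S" and inv: "\<And>z. z \<in> T \<Longrightarrow> h (J z) = z"
  shows "(J has_real_derivative inverse d) (at y within T)"
proof -
  have "filterlim J (at (J y) within S) (at y within T)"
    unfolding filterlim_at
  proof
    show "\<forall>\<^sub>F x in at y within T. J x \<in> S \<and> J x \<noteq> J y"
      unfolding eventually_at_filter using JS inv \<open>y \<in> T\<close> by (intro always_eventually) metis
    show "(J \<longlongrightarrow> J y) (at y within T)"
      using cont by (simp add: continuous_within)
  qed
  with der have "((\<lambda>z. (h (J z) - h (J y)) / (J z - J y)) \<longlongrightarrow> d) (at y within T)"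
    unfolding has_field_derivative_iff by (rule filterlim_compose)
  then have "((\<lambda>z. inverse ((h (J z) - h (J y)) / (J z - J y))) \<longlongrightarrow> inverse d) (at y within T)"
    using \<open>d \<noteq> 0\<close> by (rule tendsto_inverse)
  moreover have "\<forall>\<^sub>F z in at y within T.
      inverse ((h (J z) - h (J y)) / (J z - J y)) = (J z - J y) / (z - y)"
    unfolding eventually_at_filter using inv \<open>y \<in> T\<close> by (intro always_eventually) auto
  ultimately show ?thesis
    unfolding has_field_derivative_iff by (rule Lim_transform_eventually)
qed

lemma derivative_within_ge_secant_slope:
  fixes h :: "real \<Rightarrow> real"
  assumes "(h has_real_derivative d) (at x within S)" "at x within S \<noteq> bot" "x \<in> S"
    and "\<And>y z. y \<in> S \<Longrightarrow> z \<in> S \<Longrightarrow> y \<le> z \<Longrightarrow> k * (z - y) \<le> h z - h y"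
  shows "k \<le> d"
proof (rule tendsto_lowerbound)
  show "((\<lambda>y. (h y - h x) / (y - x)) \<longlongrightarrow> d) (at x within S)"
    using assms(1) by (simp add: has_field_derivative_iff)
  have "k \<le> (h y - h x) / (y - x)" if "y \<in> S" "y \<noteq> x" for y
  proof (cases "y < x")
    case True
    then show ?thesis
      using assms(4)[of y x] that assms(3) by (simp add: neg_le_divide_eq algebra_simps)
  next
    case False
    then show ?thesis
      using assms(4)[of x y] that assms(3) by (simp add: pos_le_divide_eq algebra_simps)
  qed
  then show "\<forall>\<^sub>F y in at x within S. k \<le> (h y - h x) / (y - x)"
    unfolding eventually_at_filter by (intro always_eventually) auto
qed (fact assms(2))

text \<open>With \<open>Q = 1 / (h' \<circ> J)\<close>, the inverse function \<open>J\<close> has derivative \<open>Q\<close>. The algebra generated by \<open>Q\<close> and the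
functions \<open>F\<^bsup>(n)\<^esup> \<circ> J\<close> and \<open>h\<^bsup>(n)\<^esup> \<circ> J\<close> is closed under differentiation, since
\<open>Q' = - Q\<^sup>3 (h'' \<circ> J)\<close>. The bound \<open>k\<close> on secant slopes makes \<open>J\<close> Lipschitz and keeps \<open>h'\<close> away from \<open>0\<close>,
also at the endpoints.\<close>

lemma smooth_within_compose_inverse:
  fixes \<alpha> \<beta> :: real
  defines "S \<equiv> {\<alpha>..\<beta>}"
  assumes F: "smooth_within S F" and h: "smooth_within S h" and "\<alpha> < \<beta>"
    and "0 < k" and slope: "\<And>x y. x \<in> S \<Longrightarrow> y \<in> S \<Longrightarrow> x \<le> y \<Longrightarrow> k * (y - x) \<le> h y - h x"
    and JS: "\<And>z. z \<in> T \<Longrightarrow> J z \<in> S" and inv: "\<And>z. z \<in> T \<Longrightarrow> h (J z) = z"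
  shows "smooth_within T (\<lambda>y. F (J y))"
proof -
  have h': "d \<noteq> 0" if "x \<in> S" "(h has_real_derivative d) (at x within S)" for x d
  proof -
    have "at x within S \<noteq> bot"
      using that(1) \<open>\<alpha> < \<beta>\<close> by (simp add: S_def trivial_limit_within)
    then show ?thesis
      using derivative_within_ge_secant_slope[OF that(2) _ that(1) slope] \<open>0 < k\<close> by auto
  qed
  have cont: "continuous_on T J"
    unfolding continuous_on_iff
  proof (intro ballI allI impI)
    fix y e :: real assume y: "y \<in> T" and "0 < e"
    have "dist (J z) (J y) < e" if z: "z \<in> T" "dist z y < k * e" for z
    proof -
      have "k * \<bar>J z - J y\<bar> \<le> \<bar>z - y\<bar>"
        using slope[of "J z" "J y"] slope[of "J y" "J z"] JS inv y z
        by (cases "J z \<le> J y") auto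
      also have "\<dots> < k * e"
        using z by (simp add: dist_real_def)
      finally show ?thesis
        using \<open>0 < k\<close> by (simp add: dist_real_def)
    qed
    then show "\<exists>d>0. \<forall>z\<in>T. dist z y < d \<longrightarrow> dist (J z) (J y) < e"
      using \<open>0 < k\<close> \<open>0 < e\<close> by (intro exI[of _ "k * e"]) auto
  qed
  obtain DF where DF: "\<And>x. x \<in> S \<Longrightarrow> DF 0 x = F x"
    "\<And>n x. x \<in> S \<Longrightarrow> (DF n has_real_derivative DF (Suc n) x) (at x within S)"
    using F unfolding smooth_within_def by metis
  obtain Dh where Dh: "\<And>x. x \<in> S \<Longrightarrow> Dh 0 x = h x"
    "\<And>n x. x \<in> S \<Longrightarrow> (Dh n has_real_derivative Dh (Suc n) x) (at x within S)"
    using h unfolding smooth_within_def by metis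
  have hder: "(h has_real_derivative Dh 1 x) (at x within S)" if "x \<in> S" for x
    using has_field_derivative_transform_within[OF Dh(2)[OF that, of 0], of 1 h] that Dh(1) by auto
  define Q where "Q = (\<lambda>y. inverse (Dh 1 (J y)))"
  define G where "G = range (\<lambda>n y. DF n (J y)) \<union> range (\<lambda>n y. Dh n (J y)) \<union> {Q}"
  have J': "(J has_real_derivative Q y) (at y within T)" if "y \<in> T" for y
    unfolding Q_def
  proof (rule has_real_derivative_inverse_within)
    show "(h has_real_derivative Dh 1 (J y)) (at (J y) within S)" "Dh 1 (J y) \<noteq> 0"
      using hder h' JS that by blast+
  qed (use that cont JS inv in \<open>auto simp: continuous_on_eq_continuous_within\<close>)
  have chain: "((\<lambda>y. D (J y)) has_real_derivative D' * Q y) (at y within T)"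
    if "y \<in> T" "(D has_real_derivative D') (at (J y) within S)" for D D' y
    using DERIV_image_chain[of D D' J y T "Q y"] J'[OF that(1)] JS
      DERIV_subset[OF that(2), of "J ` T"] by (auto simp: o_def)
  have gens: "Q \<in> generated_algebra G" "(\<lambda>y. DF n (J y)) \<in> generated_algebra G"
      "(\<lambda>y. Dh n (J y)) \<in> generated_algebra G" for n
    by (rule generated_algebra.generator, auto simp: G_def)+
  have "smooth_within T (\<lambda>y. DF 0 (J y))"
  proof (rule smooth_within_generated_algebra)
    show "(\<lambda>y. DF 0 (J y)) \<in> generated_algebra G"
      by (rule gens)
    fix H assume "H \<in> G"
    then consider n where "H = (\<lambda>y. DF n (J y))" | n where "H = (\<lambda>y. Dh n (J y))" | "H = Q"
      by (auto simp: G_def)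
    then show "\<exists>H'\<in>generated_algebra G. \<forall>y\<in>T. (H has_real_derivative H' y) (at y within T)"
    proof cases
      case (1 n)
      then show ?thesis
        by (intro bexI[of _ "\<lambda>y. DF (Suc n) (J y) * Q y"])
           (auto intro!: chain DF JS generated_algebra.mult gens)
    next
      case (2 n)
      then show ?thesis
        by (intro bexI[of _ "\<lambda>y. Dh (Suc n) (J y) * Q y"])
           (auto intro!: chain Dh JS generated_algebra.mult gens)
    next
      case 3
      have "(Q has_real_derivative (-1) * (Q y * (Dh 2 (J y) * Q y) * Q y)) (at y within T)"
        if "y \<in> T" for y
      proof -
        have "Dh 1 (J y) \<noteq> 0"
          using h' hder JS that by blast
        then show ?thesis
          unfolding Q_def using chain[OF that Dh(2)[OF JS[OF that], of 1]]
          by (auto intro!: derivative_eq_intros simp: Q_def numeral_2_eq_2)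
      qed
      then show ?thesis
        unfolding 3 by (intro bexI[of _ "\<lambda>y. (-1) * (Q y * (Dh 2 (J y) * Q y) * Q y)"] ballI
                             generated_algebra.mult generated_algebra.const gens)
    qed
  qed
  then show ?thesis
    using JS DF(1) unfolding smooth_within_def by auto
qed

text \<open>Differentiation under the integral sign: every derivative in \<open>a\<close> brings out one more factor \<open>k t\<close>.\<close>

lemma smooth_within_scaled_average:
  fixes k :: "real \<Rightarrow> real"
  assumes F: "smooth_within {0..m} F" 
    and k: "continuous_on {\<alpha>..\<beta>} k" "\<And>t. t \<in> {\<alpha>..\<beta>} \<Longrightarrow> k t \<in> {0..1}"
  shows "smooth_within {0..m} (\<lambda>a. integral {\<alpha>..\<beta>} (\<lambda>t. k t * F (a * k t)))"
proof -
  obtain D where D: "\<And>x. x \<in> {0..m} \<Longrightarrow> D 0 x = F x"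
    "\<And>n x. x \<in> {0..m} \<Longrightarrow> (D n has_real_derivative D (Suc n) x) (at x within {0..m})"
    using F unfolding smooth_within_def by metis
  have contD: "continuous_on {0..m} (D n)" for n
    using D(2) by (rule DERIV_continuous_on)
  have scaled: "a * k t \<in> {0..m}" if "a \<in> {0..m}" "t \<in> {\<alpha>..\<beta>}" for a t
    using that k(2)[of t] mult_mono[of a m "k t" 1] by auto
  define B where "B n a = integral {\<alpha>..\<beta>} (\<lambda>t. k t ^ Suc n * D n (a * k t))" for n a
  have "(B n has_real_derivative B (Suc n) a) (at a within {0..m})" if "a \<in> {0..m}" for n a
  proof -
    have "((\<lambda>a. integral (cbox \<alpha> \<beta>) (\<lambda>t. k t ^ Suc n * D n (a * k t))) has_real_derivative
        integral (cbox \<alpha> \<beta>) (\<lambda>t. k t ^ Suc (Suc n) * D (Suc n) (a * k t))) (at a within {0..m})"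
    proof (rule leibniz_rule_field_derivative)
      fix x t assume x: "x \<in> {0..m}" and t: "t \<in> cbox \<alpha> \<beta>"
      have "(D n has_real_derivative D (Suc n) (x * k t))
              (at (x * k t) within (\<lambda>a. a * k t) ` {0..m})"
        using scaled x t by (intro DERIV_subset[OF D(2)]) auto
      moreover have "((\<lambda>a. a * k t) has_real_derivative k t) (at x within {0..m})"
        by (auto intro!: derivative_eq_intros)
      ultimately have "((\<lambda>a. D n (a * k t)) has_real_derivative D (Suc n) (x * k t) * k t)
          (at x within {0..m})"
        using DERIV_image_chain[of "D n" _ "\<lambda>a. a * k t"] by (simp add: o_def)
      then show "((\<lambda>a. k t ^ Suc n * D n (a * k t)) has_real_derivative
          k t ^ Suc (Suc n) * D (Suc n) (x * k t)) (at x within {0..m})"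
        by (auto intro!: derivative_eq_intros)
    next
      fix x assume "x \<in> {0..m}"
      then show "(\<lambda>t. k t ^ Suc n * D n (x * k t)) integrable_on cbox \<alpha> \<beta>"
        using scaled
        by (intro integrable_continuous continuous_intros continuous_on_compose2[OF contD] k) (auto simp: k)
    next
      have "continuous_on ({0..m} \<times> {\<alpha>..\<beta>}) (\<lambda>x. k (snd x))"
        by (rule continuous_on_compose2[OF k(1)]) (auto intro!: continuous_intros)
      then show "continuous_on ({0..m} \<times> cbox \<alpha> \<beta>)
          (\<lambda>(x, t). k t ^ Suc (Suc n) * D (Suc n) (x * k t))"
        using scaled unfolding split_beta
        by (intro continuous_intros continuous_on_compose2[OF contD]) auto
    qed (use that in auto)
    then show ?thesis
      unfolding B_def by simp
  qed
  moreover have "B 0 a = integral {\<alpha>..\<beta>} (\<lambda>t. k t * F (a * k t))" if "a \<in> {0..m}" for a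
    unfolding B_def using that scaled D(1) by (intro integral_cong) auto
  ultimately show ?thesis
    unfolding smooth_within_def by blast
qed

lemma smooth_within_ident_mult:
  assumes "smooth_within S F"
  shows "smooth_within S (\<lambda>a. c * (a * F a))"
proof -
  obtain D where D: "\<And>x. x \<in> S \<Longrightarrow> D 0 x = F x"
    "\<And>n x. x \<in> S \<Longrightarrow> (D n has_real_derivative D (Suc n) x) (at x within S)"
    using assms unfolding smooth_within_def by metis
  let ?G = "insert (\<lambda>a. a) (range D)"
  have gens: "(\<lambda>a. a) \<in> generated_algebra ?G" "D n \<in> generated_algebra ?G" for n
    by (rule generated_algebra.generator, simp)+
  have "smooth_within S (\<lambda>a. c * (a * D 0 a))"
  proof (rule smooth_within_generated_algebra)
    show "(\<lambda>a. c * (a * D 0 a)) \<in> generated_algebra ?G"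
      by (intro generated_algebra.mult generated_algebra.const gens)
    fix H assume "H \<in> ?G"
    then consider "H = (\<lambda>a. a)" | n where "H = D n"
      by auto
    then show "\<exists>H'\<in>generated_algebra ?G. \<forall>x\<in>S. (H has_real_derivative H' x) (at x within S)"
    proof cases
      case 1
      then show ?thesis
        by (intro bexI[of _ "\<lambda>a. 1"]) (auto intro: generated_algebra.const)
    next
      case (2 n)
      then show ?thesis
        using D(2) gens by blast
    qed
  qed
  then show ?thesis
    using D(1) unfolding smooth_within_def by auto
qed

section \<open>Convexity of inverse and composed functions\<close>

text \<open>Concavity of \<open>u\<close> says that \<open>u\<close> of the average of \<open>\<sigma> x\<close> and \<open>\<sigma> y\<close> is at least the average of \<open>x\<close> and
\<open>y\<close>, which is \<open>u\<close> of \<open>\<sigma>\<close> at that average. Monotonicity of \<open>u\<close> removes \<open>u\<close> from both sides.\<close>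

lemma convex_on_inverse_of_concave:
  fixes u \<sigma> :: "real \<Rightarrow> real"
  assumes u: "concave_on S u" "strict_mono_on S u" and T: "convex T"
    and \<sigma>: "\<And>y. y \<in> T \<Longrightarrow> \<sigma> y \<in> S" "\<And>y. y \<in> T \<Longrightarrow> u (\<sigma> y) = y"
  shows "convex_on T \<sigma>"
proof (rule convex_onI[OF _ T])
  fix t x y :: real
  assume t: "0 < t" "t < 1" and xy: "x \<in> T" "y \<in> T"
  let ?z = "(1 - t) *\<^sub>R x + t *\<^sub>R y" and ?w = "(1 - t) * \<sigma> x + t * \<sigma> y"
  have z: "?z \<in> T"
    using T t xy by (intro convexD) auto
  have "convex S"
    using u(1) concave_on_imp_convex by blast
  then have w: "?w \<in> S"
    using t xy \<sigma>(1) convexD[of S "\<sigma> x" "\<sigma> y" "1 - t" t] by auto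
  have "u (\<sigma> ?z) = (1 - t) * u (\<sigma> x) + t * u (\<sigma> y)"
    using \<sigma>(2) z xy by simp
  also have "\<dots> \<le> u ?w"
    using concave_onD[OF u(1), of t "\<sigma> x" "\<sigma> y"] t xy \<sigma>(1) by auto
  finally show "\<sigma> ?z \<le> ?w"
    using strict_mono_on_less_eq[OF u(2)] \<sigma>(1) z w by blast
qed

lemma concave_on_inverse_of_convex:
  fixes u \<sigma> :: "real \<Rightarrow> real"
  assumes u: "convex_on S u" "strict_mono_on S u" and T: "convex T"
    and \<sigma>: "\<And>y. y \<in> T \<Longrightarrow> \<sigma> y \<in> S" "\<And>y. y \<in> T \<Longrightarrow> u (\<sigma> y) = y"
  shows "concave_on T \<sigma>"
  unfolding concave_on_def
proof (rule convex_onI[OF _ T])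
  fix t x y :: real
  assume t: "0 < t" "t < 1" and xy: "x \<in> T" "y \<in> T"
  let ?z = "(1 - t) *\<^sub>R x + t *\<^sub>R y" and ?w = "(1 - t) * \<sigma> x + t * \<sigma> y"
  have z: "?z \<in> T"
    using T t xy by (intro convexD) auto
  have "convex S"
    using u(1) convex_on_imp_convex by blast
  then have w: "?w \<in> S"
    using t xy \<sigma>(1) convexD[of S "\<sigma> x" "\<sigma> y" "1 - t" t] by auto
  have "u ?w \<le> (1 - t) * u (\<sigma> x) + t * u (\<sigma> y)"
    using convex_onD[OF u(1), of t "\<sigma> x" "\<sigma> y"] t xy \<sigma>(1) by auto
  also have "\<dots> = u (\<sigma> ?z)"
    using \<sigma>(2) z xy by simp
  finally have "?w \<le> \<sigma> ?z"
    using strict_mono_on_less_eq[OF u(2)] \<sigma>(1) z w by blast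
  then show "- \<sigma> ?z \<le> (1 - t) * - \<sigma> x + t * - \<sigma> y"
    by simp
qed

lemma convex_on_mono_compose:
  fixes f h :: "real \<Rightarrow> real"
  assumes f: "convex_on S f" "\<And>x. x \<in> S \<Longrightarrow> f x \<in> T" and h: "convex_on T h" "mono_on T h"
  shows "convex_on S (\<lambda>x. h (f x))"
proof (rule convex_onI)
  fix t x y :: real
  assume t: "0 < t" "t < 1" and xy: "x \<in> S" "y \<in> S"
  let ?z = "(1 - t) *\<^sub>R x + t *\<^sub>R y" and ?w = "(1 - t) * f x + t * f y"
  have "?z \<in> S"
    using f(1) t xy by (intro convexD[OF convex_on_imp_convex]) auto
  moreover have "?w \<in> T"
    using t xy f(2) convexD[OF convex_on_imp_convex[OF h(1)], of "f x" "f y" "1 - t" t] by auto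
  moreover have "f ?z \<le> ?w"
    using convex_onD[OF f(1), of t x y] t xy by auto
  ultimately have "h (f ?z) \<le> h ?w"
    using f(2) h(2) by (auto dest: mono_onD)
  also have "\<dots> \<le> (1 - t) * h (f x) + t * h (f y)"
    using convex_onD[OF h(1), of t "f x" "f y"] t xy f(2) by auto
  finally show "h (f ?z) \<le> (1 - t) * h (f x) + t * h (f y)" .
qed (rule convex_on_imp_convex[OF f(1)])

section \<open>The well\<close>

text \<open>All that the condition on the energy contributes: in terms of the square \<open>x\<close> of a position coordinate,
the potential \<open>f x - g x\<^sup>3\<close> of one plane has its top at \<open>s\<close> and reaches the level \<open>m\<close> at a point \<open>p\<close>
strictly before the top.\<close>

locale hill_well =
  fixes m g f s p :: real
  assumes g: "g > 0" and p: "0 < p" "p < s" and f: "f = 3 * g * s^2"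
    and m: "f * p - g * p^3 = m"
begin

definition u :: "real \<Rightarrow> real" where
  "u x = f * x - g * x^3"

text \<open>The second factor is nonnegative for points up to \<open>s\<close> and nonpositive beyond \<open>s\<close>, which gives the monotonicity of \<open>u\<close> on both
sides without derivatives.\<close>

lemma u_diff: "u y - u x = (y - x) * (f - g * (x^2 + x * y + y^2))"
  unfolding u_def by algebra

lemma u_0 [simp]: "u 0 = 0" and u_p [simp]: "u p = m"
  using m by (simp_all add: u_def)

lemma u_less: assumes "0 \<le> x" "x < y" "y \<le> s" shows "u x < u y"
proof -
  have "y^2 \<le> s^2" "x^2 < s^2" "x * y \<le> s * s"
    using assms by (auto intro!: power_mono power_strict_mono mult_mono)
  then have "x^2 + x * y + y^2 < 3 * s^2"
    by (simp add: power2_eq_square)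
  then have "g * (x^2 + x * y + y^2) < f"
    using g by (simp add: f)
  then have "0 < u y - u x"
    unfolding u_diff using assms by simp
  then show ?thesis by simp
qed

lemma u_le: "0 \<le> x \<Longrightarrow> x \<le> y \<Longrightarrow> y \<le> s \<Longrightarrow> u x \<le> u y"
  using u_less[of x y] by (cases "x = y") auto

lemma u_antimono: assumes "s \<le> x" "x \<le> y" shows "u y \<le> u x"
proof -
  have "s^2 \<le> y^2" "s^2 \<le> x^2" "s * s \<le> x * y"
    using assms p by (auto intro!: power_mono mult_mono)
  then have "3 * s^2 \<le> x^2 + x * y + y^2"
    by (simp add: power2_eq_square)
  then have "f \<le> g * (x^2 + x * y + y^2)"
    using g by (simp add: f)
  then have "u y - u x \<le> 0"
    unfolding u_diff using assms by (simp add: mult_nonneg_nonpos)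
  then show ?thesis by simp
qed

lemma m_pos: "m > 0"
  using u_less[of 0 p] p by simp

lemma u_strict_mono: "strict_mono_on {0..p} u"
  using p by (auto intro!: strict_mono_onI u_less)

lemma u_concave: "concave_on {0..p} u"
proof -
  have cube: "convex_on {0..p} (\<lambda>x. x ^ 3)"
    by (rule convex_on_subset[OF convex_power_odd]) auto
  moreover have "convex_on {0..p} (\<lambda>x. - f * x)"
    by (rule convex_onI) (auto simp: algebra_simps)
  ultimately have "convex_on {0..p} (\<lambda>x. - f * x + g * x ^ 3)"
    using g by (intro convex_on_add convex_on_cmul[OF _ cube]) auto
  then show ?thesis
    by (simp add: concave_on_def u_def)
qed

lemma continuous_on_u [continuous_intros]: "continuous_on A h \<Longrightarrow> continuous_on A (\<lambda>x. u (h x))"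
  unfolding u_def by (intro continuous_intros)

lemma u_image: "u ` {0..p} = {0..m}"
proof
  show "u ` {0..p} \<subseteq> {0..m}"
    using u_le[of 0] u_le[of _ p] p by force
  show "{0..m} \<subseteq> u ` {0..p}"
  proof
    fix y assume "y \<in> {0..m}"
    then show "y \<in> u ` {0..p}"
      using IVT'[of u 0 y p] p continuous_on_u[of "{0..p}" "\<lambda>x. x"] by force
  qed
qed

lemma inj_u: "inj_on u {0..p}"
  using u_strict_mono by (rule strict_mono_on_imp_inj_on)

definition \<sigma> :: "real \<Rightarrow> real" where
  "\<sigma> = the_inv_into {0..p} u"

lemma \<sigma>_bounds: "b \<in> {0..m} \<Longrightarrow> \<sigma> b \<in> {0..p}"
  and u_\<sigma>: "b \<in> {0..m} \<Longrightarrow> u (\<sigma> b) = b"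
  unfolding \<sigma>_def u_image[symmetric]
  by (auto intro!: the_inv_into_into[OF inj_u] f_the_inv_into_f[OF inj_u] simp del: atLeastAtMost_iff)

lemma \<sigma>_u: "x \<in> {0..p} \<Longrightarrow> \<sigma> (u x) = x"
  unfolding \<sigma>_def by (rule the_inv_into_f_f[OF inj_u])

lemma continuous_on_\<sigma>: "continuous_on {0..m} \<sigma>"
  unfolding \<sigma>_def u_image[symmetric] 
  by (intro continuous_on_inv_into inj_u continuous_intros) auto

lemma convex_on_\<sigma>: "convex_on {0..m} \<sigma>"
  using u_concave u_strict_mono convex_real_interval(5) \<sigma>_bounds u_\<sigma> 
  by (rule convex_on_inverse_of_concave)

lemma mono_on_\<sigma>: "mono_on {0..m} \<sigma>"
proof (rule mono_onI)
  fix x y assume xy: "x \<in> {0..m}" "y \<in> {0..m}" "x \<le> y"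
  then have "u (\<sigma> x) \<le> u (\<sigma> y)"
    by (simp add: u_\<sigma>)
  then show "\<sigma> x \<le> \<sigma> y"
    using strict_mono_on_less_eq[OF u_strict_mono] \<sigma>_bounds xy by blast
qed

lemma radicand_pos: assumes "\<bar>x\<bar> \<le> p" shows "0 < f - g * x^2"
proof -
  have "x^2 < s^2"
    using assms p by (intro power2_strict_mono) auto
  then have "x^2 < 3 * s^2"
    using zero_le_power2[of s] by linarith
  then show ?thesis
    using g by (simp add: f)
qed

text \<open>The equation \<open>b = \<sigma> b (f - g (\<sigma> b)\<^sup>2)\<close> shows that \<open>sqrt (\<sigma> b / b) = r (\<sigma> b)\<close> for \<open>b > 0\<close>; the right-hand
side has no singularity at \<open>b = 0\<close>. Splitting off \<open>r\<close> separates the elementary function from the inverse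
function \<open>\<sigma>\<close>.\<close>

definition r :: "real \<Rightarrow> real" where
  "r x = inverse (sqrt (f - g * x^2))"

definition R :: "real \<Rightarrow> real" where
  "R b = r (\<sigma> b)"

lemma r_pos: "\<bar>x\<bar> \<le> p \<Longrightarrow> 0 < r x"
  using radicand_pos by (simp add: r_def)

lemma r_square: "\<bar>x\<bar> \<le> p \<Longrightarrow> (r x)^2 * (f - g * x^2) = 1"
  using radicand_pos[of x] by (simp add: r_def power_inverse)

lemma has_derivative_r:
  assumes "\<bar>x\<bar> \<le> p"
  shows "(r has_real_derivative g * x * (r x * r x * r x)) (at x within S)"
proof -
  have pos: "0 < f - g * x^2"
    using radicand_pos[OF assms] .
  show ?thesis
    unfolding r_def using pos 
    by (auto intro!: derivative_eq_intros simp: field_simps)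
qed

lemma mono_on_r: "mono_on {0..p} r"
proof (rule mono_onI)
  fix x y assume xy: "x \<in> {0..p}" "y \<in> {0..p}" "x \<le> y"
  then have "x^2 \<le> y^2"
    by (intro power_mono) auto
  then show "r x \<le> r y"
    unfolding r_def using radicand_pos[of y] xy g
    by (intro le_imp_inverse_le) auto
qed

lemma convex_on_r: "convex_on {0..p} r"
proof (rule convex_on_realI)
  show "(r has_real_derivative g * x * (r x * r x * r x)) (at x)" if "x \<in> {0..p}" for x
    using that has_derivative_r[of x UNIV] by simp
  show "g * x * (r x * r x * r x) \<le> g * y * (r y * r y * r y)"
    if "x \<in> {0..p}" "y \<in> {0..p}" "x \<le> y" for x y
    using that g mono_onD[OF mono_on_r that] r_pos[of x] r_pos[of y]
    by (intro mult_mono) auto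
qed auto

text \<open>The differential equation \<open>r' = g x r\<^sup>3\<close> keeps polynomials in \<open>x\<close> and \<open>r\<close> closed under differentiation.\<close>

lemma smooth_within_r: "smooth_within {0..p} r"
proof (rule smooth_within_generated_algebra)
  let ?G = "{\<lambda>x. x, r}"
  have gens: "(\<lambda>x. x) \<in> generated_algebra ?G" "r \<in> generated_algebra ?G"
    by (rule generated_algebra.generator, simp)+
  then show "r \<in> generated_algebra ?G"
    by simp
  fix H assume "H \<in> ?G"
  then consider "H = (\<lambda>x. x)" | "H = r"
    by auto
  then show "\<exists>H'\<in>generated_algebra ?G. \<forall>x\<in>{0..p}. (H has_real_derivative H' x) (at x within {0..p})"
  proof cases
    case 1
    then show ?thesis
      by (intro bexI[of _ "\<lambda>a. 1"]) (auto intro: generated_algebra.const)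
  next
    case 2
    show ?thesis
      unfolding 2
      by (intro bexI[of _ "\<lambda>x. g * x * (r x * r x * r x)"] ballI has_derivative_r
           generated_algebra.mult generated_algebra.const gens) auto
  qed
qed

lemma smooth_within_u: "smooth_within {0..p} u"
proof (rule smooth_within_generated_algebra)
  let ?G = "{\<lambda>x::real. x}"
  have gen: "(\<lambda>x. x) \<in> generated_algebra ?G"
    by (rule generated_algebra.generator) simp
  have "(\<lambda>x. f * x + (-g) * (x * (x * x))) \<in> generated_algebra ?G"
    by (intro generated_algebra.intros(2-) gen)
  then show "u \<in> generated_algebra ?G"
    by (simp add: u_def[abs_def] power3_eq_cube mult.assoc)
  show "\<exists>H'\<in>generated_algebra ?G. \<forall>x\<in>{0..p}. (H has_real_derivative H' x) (at x within {0..p})"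
    if "H \<in> ?G" for H
    using that by (intro bexI[of _ "\<lambda>a. 1"]) (auto intro: generated_algebra.const)
qed

lemma smooth_within_R: "smooth_within {0..m} R"
  unfolding R_def
proof (rule smooth_within_compose_inverse[OF smooth_within_r smooth_within_u])
  \<comment> \<open>The smallest slope of the concave function \<open>u\<close> on \<open>{0..p}\<close> is its derivative at \<open>p\<close>.\<close>
  show "0 < f - g * (3 * p^2)"
    using g p by (simp add: f power_strict_mono)
  show "(f - g * (3 * p^2)) * (y - x) \<le> u y - u x" if "x \<in> {0..p}" "y \<in> {0..p}" "x \<le> y" for x y
  proof -
    have "x^2 \<le> p^2" "y^2 \<le> p^2" "x * y \<le> p * p"
      using that by (auto intro!: power_mono mult_mono)
    then have "g * (x^2 + x * y + y^2) \<le> g * (3 * p^2)"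
      using g by (intro mult_left_mono) (auto simp: power2_eq_square)
    then show ?thesis
      unfolding u_diff using that by (subst mult.commute) (intro mult_left_mono, auto)
  qed
qed (use \<sigma>_bounds u_\<sigma> p in auto)

lemma R_pos: "b \<in> {0..m} \<Longrightarrow> 0 < R b"
  unfolding R_def using \<sigma>_bounds[of b] by (intro r_pos) auto

lemma \<sigma>_eq: assumes "b \<in> {0..m}" shows "\<sigma> b = b * (R b)^2"
proof -
  have "b = \<sigma> b * (f - g * (\<sigma> b)^2)"
    using u_\<sigma>[OF assms] unfolding u_def by (simp add: power2_eq_square power3_eq_cube algebra_simps)
  then have "b * (R b)^2 = \<sigma> b * ((R b)^2 * (f - g * (\<sigma> b)^2))"
    by (metis mult.commute mult.left_commute)
  moreover have "(R b)^2 * (f - g * (\<sigma> b)^2) = 1"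
    unfolding R_def using r_square[of "\<sigma> b"] \<sigma>_bounds[OF assms] by simp
  ultimately show ?thesis
    by simp
qed

lemma mono_on_R: "mono_on {0..m} R"
  unfolding R_def using mono_onD[OF mono_on_r] mono_onD[OF mono_on_\<sigma>] \<sigma>_bounds
  by (intro mono_onI) blast

lemma convex_on_R: "convex_on {0..m} R"
  unfolding R_def using convex_on_\<sigma> \<sigma>_bounds convex_on_r mono_on_r by (rule convex_on_mono_compose)

lemma continuous_on_R: "continuous_on {0..m} R"
proof -
  have "0 < f - g * (\<sigma> b)^2" if "b \<in> {0..m}" for b
    using \<sigma>_bounds[OF that] by (intro radicand_pos) auto
  then show ?thesis
    unfolding R_def r_def by (intro continuous_intros continuous_on_\<sigma>) force
qed

end

section \<open>The action as a function of the level\<close>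

context hill_well begin

definition average_R :: "real \<Rightarrow> real" where
  "average_R a = integral {-(pi/2)..pi/2} (\<lambda>t. (cos t)^2 * R (a * (cos t)^2))"

text \<open>\<open>1 / (2 \<pi>)\<close> times the area enclosed by the level \<open>a\<close>, in a form that is visibly smooth and convex in
\<open>a\<close>; the lemma \<open>area_between_levels\<close> identifies it with the area.\<close>

definition well_action :: "real \<Rightarrow> real" where
  "well_action a = sqrt 8 / pi * (a * average_R a)"

lemma cos_square_Icc: "(cos t)^2 \<in> {0..1::real}"
  by (simp add: abs_square_le_1)

lemma cos_square_scaled: "a \<in> {0..m} \<Longrightarrow> a * (cos t)^2 \<in> {0..m}"
  using cos_square_Icc[of t] mult_mono[of a m "(cos t)^2" 1] by auto

lemma average_R_integrable:
  assumes "a \<in> {0..m}"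
  shows "(\<lambda>t. (cos t)^2 * R (a * (cos t)^2)) integrable_on {-(pi/2)..pi/2}"
  by (rule integrable_continuous_real, intro continuous_intros continuous_on_compose2[OF continuous_on_R])
     (use cos_square_scaled[OF assms] in auto)

lemma smooth_within_well_action: "smooth_within {0..m} well_action"
  unfolding well_action_def average_R_def
  by (intro smooth_within_ident_mult smooth_within_scaled_average smooth_within_R
        continuous_intros cos_square_Icc)

lemma mono_on_average_R: "mono_on {0..m} average_R"
proof (rule mono_onI)
  fix a b assume ab: "a \<in> {0..m}" "b \<in> {0..m}" "a \<le> b"
  have "R (a * (cos t)^2) \<le> R (b * (cos t)^2)" for t
    using ab cos_square_scaled by (intro mono_onD[OF mono_on_R] mult_right_mono) auto
  then show "average_R a \<le> average_R b"
    unfolding average_R_def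
    by (intro integral_le average_R_integrable ab mult_left_mono) auto
qed

lemma average_R_0_pos: "0 < average_R 0"
proof -
  have "((\<lambda>t. (cos t)^2) has_integral
      ((pi/2 + sin (pi/2) * cos (pi/2)) / 2 - (-(pi/2) + sin (-(pi/2)) * cos (-(pi/2))) / 2))
      {-(pi/2)..pi/2}"
  proof (rule fundamental_theorem_of_calculus)
    show "((\<lambda>t. (t + sin t * cos t) / 2) has_vector_derivative (cos t)^2)
        (at t within {-(pi/2)..pi/2})" for t
      unfolding has_real_derivative_iff_has_vector_derivative[symmetric]
      by (auto intro!: derivative_eq_intros simp: power2_eq_square sin_squared_eq[unfolded power2_eq_square])
  qed simp
  then have "((\<lambda>t. (cos t)^2) has_integral (pi/2)) {-(pi/2)..pi/2}"
    by simp
  from has_integral_mult_left[OF this, of "R 0"] have "((\<lambda>t. (cos t)^2 * R (0 * (cos t)^2)) has_integral pi / 2 * R 0) {-(pi/2)..pi/2}"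
    by simp
  then have "average_R 0 = pi / 2 * R 0"
    unfolding average_R_def by (rule integral_unique)
  moreover have "0 < pi / 2 * R 0"
    using R_pos[of 0] m_pos by (intro mult_pos_pos) auto
  ultimately show ?thesis
    by simp
qed

lemma average_R_pos: "a \<in> {0..m} \<Longrightarrow> 0 < average_R a"
  using mono_onD[OF mono_on_average_R, of 0 a] average_R_0_pos by simp

lemma convex_on_average_R: "convex_on {0..m} average_R"
proof (rule convex_onI)
  fix t a b :: real
  assume t: "0 < t" "t < 1" and ab: "a \<in> {0..m}" "b \<in> {0..m}"
  let ?w = "\<lambda>c \<theta>. (cos \<theta>)^2 * R (c * (cos \<theta>)^2)"
  let ?c = "(1 - t) *\<^sub>R a + t *\<^sub>R b"
  have c: "?c \<in> {0..m}"
    using convexD[of "{0..m}" a b "1 - t" t] t ab by auto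
  have "?w ?c \<theta> \<le> (1 - t) * ?w a \<theta> + t * ?w b \<theta>" for \<theta>
  proof -
    have "R (?c * (cos \<theta>)^2) \<le> (1 - t) * R (a * (cos \<theta>)^2) + t * R (b * (cos \<theta>)^2)"
      using convex_onD[OF convex_on_R, of t "a * (cos \<theta>)^2" "b * (cos \<theta>)^2"]
        t ab cos_square_scaled by (simp add: algebra_simps)
    from mult_left_mono[OF this zero_le_power2[of "cos \<theta>"]] show ?thesis
      by (simp only: distrib_left mult.left_commute)
  qed
  then have "average_R ?c \<le> integral {-(pi/2)..pi/2} (\<lambda>\<theta>. (1 - t) * ?w a \<theta> + t * ?w b \<theta>)"
    unfolding average_R_def
    by (intro integral_le average_R_integrable[OF c] integrable_add integrable_on_mult_right
          average_R_integrable ab)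
  also have "\<dots> = (1 - t) * average_R a + t * average_R b"
    unfolding average_R_def using ab
    by (subst integral_add) (auto intro!: integrable_on_mult_right average_R_integrable)
  finally show "average_R ?c \<le> (1 - t) * average_R a + t * average_R b" .
qed auto

lemma well_action_0 [simp]: "well_action 0 = 0"
  by (simp add: well_action_def)

text \<open>A product of two nonnegative nondecreasing convex functions is convex.\<close>

lemma convex_on_well_action: "convex_on {0..m} well_action"
proof -
  have "convex_on {0..m} (\<lambda>a. a * average_R a)"
    using average_R_pos
    by (intro convex_on_mul convex_on_average_R mono_on_average_R)
       (auto simp: convex_on_ident mono_on_def less_imp_le)
  from convex_on_cmul[OF _ this, of "sqrt 8 / pi"] show ?thesis
    by (simp add: well_action_def[abs_def])
qed

text \<open>Since \<open>average_R\<close> is nondecreasing, \<open>a \<mapsto> a * average_R a\<close> grows at least as fast as \<open>a * average_R 0\<close>. This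
linear lower bound yields the strict monotonicity of the action and a derivative that stays positive up to
the endpoints.\<close>

lemma well_action_slope:
  assumes "a \<in> {0..m}" "b \<in> {0..m}" "a \<le> b"
  shows "sqrt 8 / pi * average_R 0 * (b - a) \<le> well_action b - well_action a"
proof -
  have mono: "average_R 0 \<le> average_R a" "average_R a \<le> average_R b"
    using assms by (auto intro!: mono_onD[OF mono_on_average_R])
  then have "average_R 0 * (b - a) \<le> average_R b * (b - a)"
    using assms by (intro mult_right_mono) auto
  moreover have "a * average_R a \<le> a * average_R b"
    using mono assms by (intro mult_left_mono) auto
  ultimately have "average_R 0 * (b - a) \<le> b * average_R b - a * average_R a"
    by (simp add: algebra_simps)
  then have "sqrt 8 / pi * (average_R 0 * (b - a))
      \<le> sqrt 8 / pi * (b * average_R b - a * average_R a)"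
    by (intro mult_left_mono) auto
  then show ?thesis
    unfolding well_action_def by (simp only: right_diff_distrib mult.assoc)
qed

lemma slope_pos: "0 < sqrt 8 / pi * average_R 0"
  using average_R_0_pos by simp

lemma strict_mono_on_well_action: "strict_mono_on {0..m} well_action"
proof (rule strict_mono_onI)
  fix a b assume ab: "a \<in> {0..m}" "b \<in> {0..m}" "a < b"
  then have "0 < sqrt 8 / pi * average_R 0 * (b - a)"
    by (intro mult_pos_pos[OF slope_pos]) auto
  then show "well_action a < well_action b"
    using well_action_slope[of a b] ab by linarith
qed

lemma well_action_image: "well_action ` {0..m} = {0..well_action m}"
proof
  have mono: "well_action a \<le> well_action b" if "a \<in> {0..m}" "b \<in> {0..m}" "a \<le> b" for a b
    using strict_mono_on_leD[OF strict_mono_on_well_action] that by blast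
  then show "well_action ` {0..m} \<subseteq> {0..well_action m}"
    using m_pos mono[of 0] by force
  obtain D where "\<And>x. x \<in> {0..m} \<Longrightarrow> D 0 x = well_action x"
    "\<And>n x. x \<in> {0..m} \<Longrightarrow> (D n has_real_derivative D (Suc n) x) (at x within {0..m})"
    using smooth_within_well_action unfolding smooth_within_def by metis
  then have "continuous_on {0..m} well_action"
    using DERIV_continuous_on[of "{0..m}" "D 0" "D (Suc 0)"] by (simp cong: continuous_on_cong_simp)
  then show "{0..well_action m} \<subseteq> well_action ` {0..m}"
    using IVT'[of well_action 0 _ m] m_pos by force
qed

text \<open>The slice at height \<open>y\<close> is the interval \<open>x\<^sup>2 < \<sigma> (a - y\<^sup>2 / 8)\<close>. After \<open>y = sqrt (8 a) sin t\<close> the argument of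
\<open>\<sigma>\<close> is \<open>a cos\<^sup>2 t\<close>, and \<open>\<sigma> b = b (R b)\<^sup>2\<close> takes the square root out of the width of the slice.\<close>

lemma area_between_levels:
  assumes "a \<in> {0..m}"
  shows "measure lebesgue {(x, y). x^2 < s \<and> plane_K f g (x, y) < a} = 2 * pi * well_action a"
proof -
  define D where "D = {(x, y). x^2 < s \<and> plane_K f g (x, y) < a}"
  have K: "plane_K f g (x, y) = y^2 / 8 + u (x^2)" for x y
    by (simp add: plane_K_def u_def)
  have "D = {x. (fst x)^2 < s} \<inter> {x. (snd x)^2 / 8 + u ((fst x)^2) < a}"
    by (auto simp: D_def K)
  also have "open \<dots>"
    by (intro open_Int open_Collect_less continuous_intros) auto
  finally have D_borel [measurable]: "D \<in> sets borel"
    by simp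
  define width where "width y = 2 * sqrt (\<sigma> (a - y^2 / 8))" for y
  define c where "c = sqrt (8 * a)"
  have c: "c^2 = 8 * a" "0 \<le> c"
    using assms by (auto simp: c_def)
  have level: "a - y^2 / 8 \<in> {0..m}" if "y \<in> {-c..c}" for y
  proof -
    have "\<bar>y\<bar> \<le> \<bar>c\<bar>"
      using that by auto
    then have "y^2 \<le> c^2"
      by (simp only: abs_le_square_iff)
    then have "0 \<le> y^2 / 8" "y^2 / 8 \<le> a"
      by (simp_all add: c)
    then show ?thesis
      using assms unfolding atLeastAtMost_iff by linarith
  qed
  have slice: "emeasure lborel ((\<lambda>x. (x, y)) -` D) = ennreal (width y) * indicator {-c..c} y" for y
  proof (cases "y \<in> {-c..c}")
    case True
    let ?b = "a - y^2 / 8"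
    have \<sigma>b: "\<sigma> ?b \<in> {0..p}" "u (\<sigma> ?b) = ?b"
      using level[OF True] \<sigma>_bounds u_\<sigma> by auto
    have "x^2 < s \<and> u (x^2) < ?b \<longleftrightarrow> x^2 < \<sigma> ?b" for x
    proof
      show "x^2 < \<sigma> ?b" if "x^2 < s \<and> u (x^2) < ?b"
        using u_le[of "\<sigma> ?b" "x^2"] \<sigma>b that by (intro not_le_imp_less notI) auto
      show "x^2 < s \<and> u (x^2) < ?b" if "x^2 < \<sigma> ?b"
        using u_less[of "x^2" "\<sigma> ?b"] \<sigma>b p that by simp
    qed
    moreover have "x^2 < \<sigma> ?b \<longleftrightarrow> x \<in> {- sqrt (\<sigma> ?b)<..<sqrt (\<sigma> ?b)}" for x
    proof -
      have "x^2 < \<sigma> ?b \<longleftrightarrow> \<bar>x\<bar> < sqrt (\<sigma> ?b)"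
        using real_sqrt_less_iff[of "x^2" "\<sigma> ?b"] by (simp only: real_sqrt_abs)
      then show ?thesis
        by auto
    qed
    ultimately have "(\<lambda>x. (x, y)) -` D = {- sqrt (\<sigma> ?b)<..<sqrt (\<sigma> ?b)}"
      by (auto simp only: D_def K vimage_def mem_Collect_eq case_prod_conv less_diff_eq add.commute)
    then show ?thesis
      using True \<sigma>b by (simp add: width_def)
  next
    case False
    then have "c^2 < y^2"
      unfolding not_le[symmetric] abs_le_square_iff[symmetric] using c(2) by auto
    then have "a - y^2 / 8 < 0"
      by (simp add: c)
    moreover have "0 \<le> u (x^2)" if "x^2 < s" for x
      using that u_le[of 0 "x^2"] by simp
    ultimately have "(\<lambda>x. (x, y)) -` D = {}"
      by (fastforce simp: D_def K)
    then show ?thesis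
      using False by simp
  qed
  have width_cont: "continuous_on {-c..c} width"
    unfolding width_def using level
    by (intro continuous_intros continuous_on_compose2[OF continuous_on_\<sigma>]) auto
  have "((\<lambda>t. (c * cos t) *\<^sub>R width (c * sin t)) has_integral
      integral {c * sin (-(pi/2))..c * sin (pi/2)} width) {-(pi/2)..pi/2}"
  proof (rule has_integral_substitution[OF _ _ _ width_cont])
    have "c * sin t \<in> {-c..c}" for t
      using c(2) mult_left_mono[of "sin t" 1 c] mult_left_mono[of "-1" "sin t" c] by simp
    then show "(\<lambda>t. c * sin t) ` {-(pi/2)..pi/2} \<subseteq> {-c..c}"
      by blast
  qed (use c in \<open>auto intro!: derivative_eq_intros\<close>)
  moreover have "(c * cos t) *\<^sub>R width (c * sin t)
      = 2 * sqrt 8 * a * ((cos t)^2 * R (a * (cos t)^2))" if "t \<in> {-(pi/2)..pi/2}" for t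
  proof -
    have "0 \<le> cos t"
      using that by (intro cos_ge_zero) auto
    have "a - (c * sin t)^2 / 8 = a * (cos t)^2"
      by (simp add: power_mult_distrib c cos_squared_eq algebra_simps)
    then have "width (c * sin t) = 2 * sqrt (a * (cos t)^2 * (R (a * (cos t)^2))^2)"
      using \<sigma>_eq[OF cos_square_scaled[OF assms]] by (simp add: width_def)
    also have "\<dots> = 2 * (sqrt a * (cos t * R (a * (cos t)^2)))"
      using \<open>0 \<le> cos t\<close> R_pos[OF cos_square_scaled[OF assms, of t]] by (simp add: real_sqrt_mult)
    finally have w: "width (c * sin t) = 2 * (sqrt a * (cos t * R (a * (cos t)^2)))" .
    have "c * sqrt a = sqrt 8 * a"
      using assms by (simp add: c_def real_sqrt_mult)
    moreover have "c * cos t * (2 * (sqrt a * (cos t * R (a * (cos t)^2))))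
        = 2 * (c * sqrt a) * ((cos t)^2 * R (a * (cos t)^2))"
      by (simp only: power2_eq_square mult_ac)
    ultimately show ?thesis
      by (simp only: w real_scaleR_def mult.assoc)
  qed
  ultimately have "((\<lambda>t. 2 * sqrt 8 * a * ((cos t)^2 * R (a * (cos t)^2))) has_integral
      integral {-c..c} width) {-(pi/2)..pi/2}"
    by (subst has_integral_cong[symmetric]) auto
  from integral_unique[OF this] have "integral {-c..c} width = 2 * sqrt 8 * a * average_R a"
    by (simp add: average_R_def)
  then have I: "(width has_integral (2 * pi * well_action a)) {-c..c}"
    using integrable_integral[OF integrable_continuous_real[OF width_cont]]
    by (simp add: well_action_def mult.assoc)
  have width_nonneg: "0 \<le> width y" if "y \<in> {-c..c}" for y
    using \<sigma>_bounds[OF level[OF that]] by (simp add: width_def)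
  have "emeasure lborel D = (\<integral>\<^sup>+y. emeasure lborel ((\<lambda>x. (x, y)) -` D) \<partial>lborel)"
    using lborel_pair.emeasure_pair_measure_alt2[of D]
    unfolding lborel_prod by simp
  also have "\<dots> = (\<integral>\<^sup>+y. ennreal (width y) * indicator {-c..c} y \<partial>lborel)"
    by (simp only: slice)
  also have "\<dots> = ennreal (2 * pi * well_action a)"
    by (rule nn_integral_has_integral_lebesgue'[OF width_nonneg I])
  finally have "emeasure lborel D = ennreal (2 * pi * well_action a)" .
  moreover have "0 \<le> well_action a"
    using has_integral_nonneg[OF I width_nonneg] pi_gt_zero by (auto simp: zero_le_mult_iff)
  ultimately have "measure lborel D = 2 * pi * well_action a"
    by (simp add: measure_def)
  then show ?thesis
    using measure_completion[of D lborel] D_borel unfolding D_def[symmetric] by simp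
qed

section \<open>The moment curve as a convex graph\<close>

definition \<phi> :: "real \<Rightarrow> real" where
  "\<phi> x = well_action (m - the_inv_into {0..m} well_action x)"

lemma inverse_action:
  shows "x \<in> {0..well_action m} \<Longrightarrow> the_inv_into {0..m} well_action x \<in> {0..m}"
    and "x \<in> {0..well_action m} \<Longrightarrow> well_action (the_inv_into {0..m} well_action x) = x"
    and "a \<in> {0..m} \<Longrightarrow> the_inv_into {0..m} well_action (well_action a) = a"
proof -
  note inj = strict_mono_on_imp_inj_on[OF strict_mono_on_well_action]
  show "x \<in> {0..well_action m} \<Longrightarrow> the_inv_into {0..m} well_action x \<in> {0..m}"
    unfolding well_action_image[symmetric] by (rule the_inv_into_into[OF inj]) auto
  show "x \<in> {0..well_action m} \<Longrightarrow> well_action (the_inv_into {0..m} well_action x) = x"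
    unfolding well_action_image[symmetric] by (rule f_the_inv_into_f[OF inj])
  show "a \<in> {0..m} \<Longrightarrow> the_inv_into {0..m} well_action (well_action a) = a"
    by (rule the_inv_into_f_f[OF inj])
qed

lemma action_graph:
  "(\<lambda>a. (well_action a, well_action (m - a))) ` {0..m} = {(x, \<phi> x) | x. x \<in> {0..well_action m}}"
  (is "?L = ?R")
proof
  have "well_action a \<in> {0..well_action m}" if "a \<in> {0..m}" for a
    using that well_action_image by blast
  then show "?L \<subseteq> ?R"
    by (auto simp: \<phi>_def inverse_action)
  show "?R \<subseteq> ?L"
    using inverse_action(1,2) by (force simp: \<phi>_def image_iff)
qed

lemma smooth_within_\<phi>: "smooth_within {0..well_action m} \<phi>"
  unfolding \<phi>_def
  by (rule smooth_within_compose_inverse[OF smooth_within_reflect[OF smooth_within_well_action]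
        smooth_within_well_action m_pos slope_pos well_action_slope])
     (use inverse_action in auto)

lemma concave_on_inverse_action: "concave_on {0..well_action m} (the_inv_into {0..m} well_action)"
  using convex_on_well_action strict_mono_on_well_action convex_real_interval(5) inverse_action(1,2)
  by (rule concave_on_inverse_of_convex)

text \<open>\<open>\<phi>\<close> is the convex nondecreasing action applied to the convex function \<open>m - I\<inverse> x\<close>.\<close>

lemma convex_on_\<phi>: "convex_on {0..well_action m} \<phi>"
  unfolding \<phi>_def
proof (rule convex_on_mono_compose[OF _ _ convex_on_well_action])
  show "convex_on {0..well_action m} (\<lambda>x. m - the_inv_into {0..m} well_action x)"
    using concave_on_inverse_action by (intro convex_on_diff) (auto simp: convex_on_const)
  show "m - the_inv_into {0..m} well_action x \<in> {0..m}" if "x \<in> {0..well_action m}" for x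
    using inverse_action(1)[OF that] by auto
  show "mono_on {0..m} well_action"
    using strict_mono_on_well_action by (rule strict_mono_on_imp_mono_on)
qed

lemma antimono_on_\<phi>: "antimono_on {0..well_action m} \<phi>"
proof (rule monotone_onI)
  fix x y assume xy: "x \<in> {0..well_action m}" "y \<in> {0..well_action m}" "x \<le> y"
  let ?J = "the_inv_into {0..m} well_action"
  have J: "?J x \<in> {0..m}" "?J y \<in> {0..m}"
    using xy inverse_action(1) by auto
  have "?J x \<le> ?J y"
    using strict_mono_on_less_eq[OF strict_mono_on_well_action J] inverse_action(2) xy by simp
  then show "\<phi> x \<ge> \<phi> y"
    unfolding \<phi>_def using J by (intro strict_mono_on_leD[OF strict_mono_on_well_action]) auto
qed

end

section \<open>Components and enclosed regions\<close>

lemma connected_clopen_in_components: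
  assumes "connected C" "C \<noteq> {}"
    and U: "open U" "C = L \<inter> U" and F: "closed F" "C = L \<inter> F"
  shows "C \<in> components L"
  unfolding in_components_maximal
proof (intro conjI allI impI)
  fix D assume D: "D \<noteq> {} \<and> C \<subseteq> D \<and> D \<subseteq> L \<and> connected D"
  have "U \<inter> D = {} \<or> - F \<inter> D = {}"
    using connectedD[of D U "- F"] D U F by blast
  then show "D = C"
    using D U(2) F(2) \<open>C \<noteq> {}\<close> by blast
qed (use assms in auto)

text \<open>A connected set that starts in \<open>D\<close> and avoids \<open>S\<close> cannot cross the frontier of \<open>D\<close>, so it stays in the
bounded set \<open>D\<close>.\<close>

lemma open_bounded_subset_inside:
  assumes "open D" "bounded D" "frontier D \<subseteq> S" "D \<inter> S = {}"
  shows "D \<subseteq> inside S"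
proof
  fix x assume x: "x \<in> D"
  let ?C = "connected_component_set (- S) x"
  have "?C \<subseteq> - S"
    by (rule connected_component_subset)
  moreover have "x \<in> ?C"
    using x assms(4) by (auto intro: connected_component_refl)
  ultimately have "?C - D = {}"
    using connected_Int_frontier[OF connected_connected_component, of "- S" x D] x assms(3) by blast
  then show "x \<in> inside S"
    using x assms(2,4) bounded_subset[of D ?C] by (auto simp: inside_def)
qed

lemma not_inside_if_escapes:
  assumes "connected T" "T \<inter> S = {}" "x \<in> T" "\<not> bounded T"
  shows "x \<notin> inside S"
proof -
  have "T \<subseteq> connected_component_set (- S) x"
    using assms by (intro connected_component_maximal) auto
  then show ?thesis
    using assms(4) bounded_subset by (auto simp: inside_def)
qed

text \<open>Supplies the unbounded connected sets for \<open>not_inside_if_escapes\<close> and for the components of the level set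
outside the well.\<close>

lemma unbounded_image_of_ray:
  fixes \<gamma> :: "real \<Rightarrow> 'a::real_normed_vector"
  assumes "\<And>t. t \<ge> t0 \<Longrightarrow> k * t \<le> norm (\<gamma> t)" "k > 0"
  shows "\<not> bounded (\<gamma> ` {t0..})"
proof
  assume "bounded (\<gamma> ` {t0..})"
  then obtain b where b: "\<And>t. t \<ge> t0 \<Longrightarrow> norm (\<gamma> t) \<le> b"
    unfolding bounded_iff by auto
  have "k * max t0 (b / k + 1) \<le> b"
    using assms(1)[of "max t0 (b / k + 1)"] b[of "max t0 (b / k + 1)"] by linarith
  moreover have "k * (b / k + 1) \<le> k * max t0 (b / k + 1)"
    using assms(2) by (intro mult_left_mono) auto
  ultimately show False
    using assms(2) by (simp add: distrib_left)
qed

section \<open>Levi-Civita regularization\<close>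

text \<open>The decisive identity is
\<open>\<bar>z\<bar>\<^sup>2 ((Re (z\<^sup>2))\<^sup>2 + (Im (z\<^sup>2))\<^sup>2 / 4) = (Re z)\<^sup>6 + (Im z)\<^sup>6\<close>: with the factor \<open>1 / 4\<close> in the potential the
mixed terms cancel, and the regularized problem separates.\<close>

lemma levi_civita_pullback:
  assumes "z \<noteq> 0"
  shows "(cmod z)^2 * (hill_H m g (levi_civita (z, w)) + f) = reg_K f g (z, w) - m"
proof -
  define N where "N = (cmod z)^2"
  have N: "N \<noteq> 0" and N_eq: "N = (Re z)^2 + (Im z)^2"
    using assms by (simp add: N_def) (simp add: N_def cmod_power2)
  have "(cmod (w / (2 * cnj z)))^2 / 2 = (cmod w)^2 / (8 * N)"
    by (simp add: norm_divide norm_mult power_divide power_mult_distrib N_def)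
  moreover have "cmod (z^2) = N"
    by (simp add: norm_power N_def)
  ultimately have "N * (hill_H m g (levi_civita (z, w)) + f)
      = N * ((cmod w)^2 / (8 * N) - m / N - g * (Re (z^2))^2 - g * ((Im (z^2))^2 / 4) + f)"
    by (simp add: hill_H_def levi_civita_def hill_V_def)
  also have "\<dots> = (cmod w)^2 / 8 - m + f * N - g * (N * ((Re (z^2))^2 + (Im (z^2))^2 / 4))"
    using N by (simp add: field_simps)
  also have "N * ((Re (z^2))^2 + (Im (z^2))^2 / 4) = (Re z)^6 + (Im z)^6"
    unfolding N_eq Re_power2 Im_power2 by (simp add: power_mult_distrib) algebra
  finally show ?thesis
    by (simp add: reg_K_def N_def cmod_power2)
qed

lemma levi_civita_in_energy_hypersurface_iff:
  assumes "z \<noteq> 0"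
  shows "levi_civita (z, w) \<in> energy_hypersurface m g f \<longleftrightarrow> reg_K f g (z, w) = m"
proof -
  have "levi_civita (z, w) \<in> energy_hypersurface m g f \<longleftrightarrow>
      hill_H m g (levi_civita (z, w)) + f = 0"
    using assms by (auto simp: energy_hypersurface_def levi_civita_def)
  also have "\<dots> \<longleftrightarrow> (cmod z)^2 * (hill_H m g (levi_civita (z, w)) + f) = 0"
    using assms by simp
  finally show ?thesis
    by (simp add: levi_civita_pullback[OF assms])
qed

lemma fst_levi_civita: "fst (levi_civita (z, w)) = z^2"
  by (simp add: levi_civita_def)

lemma levi_civita_surj:
  assumes "q \<noteq> 0"
  shows "\<exists>z w. z \<noteq> 0 \<and> levi_civita (z, w) = (q, v)"
  using assms
  by (intro exI[of _ "csqrt q"] exI[of _ "2 * cnj (csqrt q) * v"]) (auto simp: levi_civita_def)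

text \<open>Expresses a box in the coordinates of \<open>z\<close> through \<open>q = z\<^sup>2\<close> alone, independently of the choice of the square
root.\<close>

lemma cmod_square_plus_Re: "cmod (z^2) + \<bar>Re (z^2)\<bar> = 2 * max ((Re z)^2) ((Im z)^2)"
  by (simp add: norm_power cmod_power2 Re_power2 max_def)

section \<open>The bounded component\<close>

context hill_well begin

definition bounded_part :: "(complex \<times> complex) set" where
  "bounded_part = {(z, w). reg_K f g (z, w) = m \<and> (Re z)^2 \<le> p \<and> (Im z)^2 \<le> p}"

lemma plane_K_u: "plane_K f g (x, y) = y^2 / 8 + u (x^2)"
  by (simp add: plane_K_def u_def)

lemma reg_K_u: "reg_K f g (z, w) = (cmod w)^2 / 8 + u ((Re z)^2) + u ((Im z)^2)"
  by (simp add: reg_K_def u_def algebra_simps)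

text \<open>Within the well both potential terms and the kinetic term are nonnegative, so none of them exceeds \<open>m\<close>,
and \<open>u\<close> stays at most \<open>m\<close> only up to \<open>p\<close>. The gap between \<open>p\<close> and \<open>s\<close> is what isolates the bounded part.\<close>

lemma in_well:
  assumes K: "reg_K f g (z, w) \<le> m" and s: "(Re z)^2 \<le> s" "(Im z)^2 \<le> s"
  shows "(Re z)^2 \<le> p" "(Im z)^2 \<le> p" "(cmod w)^2 \<le> 8 * m"
proof -
  have nonneg: "0 \<le> u ((Re z)^2)" "0 \<le> u ((Im z)^2)" "0 \<le> (cmod w)^2"
    using u_le[of 0] s by force+
  show "(Re z)^2 \<le> p"
    using u_less[of p "(Re z)^2"] nonneg K s p unfolding reg_K_u by force
  show "(Im z)^2 \<le> p"
    using u_less[of p "(Im z)^2"] nonneg K s p unfolding reg_K_u by force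
  show "(cmod w)^2 \<le> 8 * m"
    using nonneg K unfolding reg_K_u by linarith
qed

lemma bounded_part_eq_open_box: "bounded_part = regularized_hypersurface m g f \<inter> {x. (Re (fst x))^2 < s \<and> (Im (fst x))^2 < s}"
  using in_well p by (fastforce simp: bounded_part_def regularized_hypersurface_def)

lemma bounded_part_eq_closed_box: "bounded_part = regularized_hypersurface m g f \<inter> {x. (Re (fst x))^2 \<le> p \<and> (Im (fst x))^2 \<le> p}"
  by (auto simp: bounded_part_def regularized_hypersurface_def)

text \<open>The coordinate \<open>X\<close> with \<open>X\<^sup>2 = u (x\<^sup>2)\<close> and the sign of \<open>x\<close>, in which \<open>y\<^sup>2 / 8 + u (x\<^sup>2)\<close> becomes a sum of
squares. The function \<open>unstraighten\<close> inverts it on the well.\<close>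

definition straighten :: "real \<Rightarrow> real" where
  "straighten x = x * sqrt (f - g * (x^2)^2)"

definition unstraighten :: "real \<Rightarrow> real" where
  "unstraighten X = X * R (X^2)"

lemma straighten_square:
  assumes "x^2 \<le> p"
  shows "(straighten x)^2 = u (x^2)"
proof -
  have "0 < f - g * (x^2)^2"
    using assms by (intro radicand_pos) auto
  then show ?thesis
    by (simp add: straighten_def u_def power_mult_distrib algebra_simps flip: power_mult power_add)
qed

lemma unstraighten_square: "X^2 \<le> m \<Longrightarrow> (unstraighten X)^2 = \<sigma> (X^2)"
  using \<sigma>_eq[of "X^2"] by (simp add: unstraighten_def power_mult_distrib)

lemma unstraighten_straighten:
  assumes "x^2 \<le> p"
  shows "unstraighten (straighten x) = x"
proof -
  have "0 < f - g * (x^2)^2"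
    using assms by (intro radicand_pos) auto
  then show ?thesis
    unfolding unstraighten_def straighten_square[OF assms]
    using \<sigma>_u[of "x^2"] assms by (simp add: R_def r_def straighten_def)
qed

lemma unstraighten_eq_0_iff: "X^2 \<le> m \<Longrightarrow> unstraighten X = 0 \<longleftrightarrow> X = 0"
  using R_pos[of "X^2"] by (auto simp: unstraighten_def)

text \<open>The sphere \<open>\<bar>X\<bar>\<^sup>2 + \<bar>Y\<bar>\<^sup>2 = m\<close>, parametrized by \<open>Y\<close> in the closed disc and the argument \<open>\<theta>\<close> of \<open>X\<close>, and then
mapped to the bounded part. The points with \<open>X \<noteq> 0\<close>, that is \<open>z \<noteq> 0\<close>, come exactly from the open disc, so
the connectedness of both sets is that of a line times a disc.\<close>

definition sphere_chart :: "real \<times> complex \<Rightarrow> complex \<times> complex" where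
  "sphere_chart = (\<lambda>(\<theta>, Y). let X = complex_of_real (sqrt (m - (cmod Y)^2)) * cis \<theta> in
     (Complex (unstraighten (Re X)) (unstraighten (Im X)), complex_of_real (sqrt 8) * Y))"

lemma continuous_on_unstraighten:
  assumes "continuous_on A h" "\<And>x. x \<in> A \<Longrightarrow> (h x)^2 \<le> m"
  shows "continuous_on A (\<lambda>x. unstraighten (h x))"
  unfolding unstraighten_def using assms
  by (intro continuous_intros continuous_on_compose2[OF continuous_on_R]) auto

lemma sphere_point:
  fixes Y :: complex and \<theta> :: real
  assumes "Y \<in> cball 0 (sqrt m)"
  defines "X \<equiv> complex_of_real (sqrt (m - (cmod Y)^2)) * cis \<theta>"
  shows "(Re X)^2 + (Im X)^2 = m - (cmod Y)^2" "(Re X)^2 \<le> m" "(Im X)^2 \<le> m"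
proof -
  have "(cmod Y)^2 \<le> m"
    using assms(1) sqrt_ge_absD[of "cmod Y" m] by simp
  then have "(cmod X)^2 = m - (cmod Y)^2"
    by (simp add: X_def norm_mult)
  then show eq: "(Re X)^2 + (Im X)^2 = m - (cmod Y)^2"
    by (simp only: cmod_power2)
  show "(Re X)^2 \<le> m" "(Im X)^2 \<le> m"
    using eq zero_le_power2[of "cmod Y"] zero_le_power2[of "Re X"] zero_le_power2[of "Im X"] by linarith+
qed

lemma continuous_on_sphere_chart: "continuous_on (UNIV \<times> cball 0 (sqrt m)) sphere_chart"
proof -
  have "continuous_on (UNIV \<times> cball 0 (sqrt m)) (\<lambda>x. sphere_chart (fst x, snd x))"
    unfolding sphere_chart_def Let_def split_beta fst_conv snd_conv complex_eq_iff Complex_eq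
    by (intro continuous_intros continuous_on_unstraighten sphere_point)
       (auto simp: cis_conv_exp intro!: continuous_intros)
  then show ?thesis
    by simp
qed

lemma sphere_chart_range:
  assumes "Y \<in> cball 0 (sqrt m)"
  shows "sphere_chart (\<theta>, Y) \<in> bounded_part" "fst (sphere_chart (\<theta>, Y)) = 0 \<longleftrightarrow> cmod Y = sqrt m"
proof -
  define X where "X = complex_of_real (sqrt (m - (cmod Y)^2)) * cis \<theta>"
  note X = sphere_point[OF assms, of \<theta>, folded X_def]
  have eq: "sphere_chart (\<theta>, Y) = (Complex (unstraighten (Re X)) (unstraighten (Im X)), complex_of_real (sqrt 8) * Y)"
    by (simp add: sphere_chart_def X_def Let_def)
  have "u (\<sigma> ((Re X)^2)) = (Re X)^2" "u (\<sigma> ((Im X)^2)) = (Im X)^2"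
    "\<sigma> ((Re X)^2) \<le> p" "\<sigma> ((Im X)^2) \<le> p"
    using u_\<sigma> \<sigma>_bounds[of "(Re X)^2"] \<sigma>_bounds[of "(Im X)^2"] X by auto
  then show "sphere_chart (\<theta>, Y) \<in> bounded_part"
    using X unfolding eq bounded_part_def by (simp add: reg_K_u unstraighten_square norm_mult power_mult_distrib)
  have "fst (sphere_chart (\<theta>, Y)) = 0 \<longleftrightarrow> X = 0"
    unfolding eq using X unstraighten_eq_0_iff by (simp add: complex_eq_iff)
  also have "\<dots> \<longleftrightarrow> (cmod Y)^2 = m"
    using X(1) by (auto simp: complex_eq_iff sum_power2_eq_zero_iff)
  also have "\<dots> \<longleftrightarrow> cmod Y = sqrt m"
    using m_pos by (metis norm_ge_zero real_sqrt_pow2 real_sqrt_unique less_imp_le)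
  finally show "fst (sphere_chart (\<theta>, Y)) = 0 \<longleftrightarrow> cmod Y = sqrt m" .
qed

lemma sphere_chart_onto:
  assumes "(z, w) \<in> bounded_part"
  shows "\<exists>\<theta>. \<exists>Y\<in>cball 0 (sqrt m). sphere_chart (\<theta>, Y) = (z, w)"
proof -
  define X where "X = Complex (straighten (Re z)) (straighten (Im z))"
  define Y where "Y = w / complex_of_real (sqrt 8)"
  have z: "(Re z)^2 \<le> p" "(Im z)^2 \<le> p" and K: "reg_K f g (z, w) = m"
    using assms by (auto simp: bounded_part_def)
  have "(cmod X)^2 + (cmod Y)^2 = m"
    using K z by (simp add: X_def Y_def reg_K_u norm_divide power_divide cmod_power2[of "Complex _ _"] straighten_square)
  then have X: "cmod X = sqrt (m - (cmod Y)^2)" and Y: "(cmod Y)^2 \<le> m"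
    by (auto intro!: real_sqrt_unique[symmetric] simp: algebra_simps)
  have polar: "complex_of_real (sqrt (m - (cmod Y)^2)) * cis (Arg X) = X"
    using rcis_cmod_Arg[of X] unfolding rcis_def X .
  have "sphere_chart (Arg X, Y)
      = (Complex (unstraighten (Re X)) (unstraighten (Im X)), complex_of_real (sqrt 8) * Y)"
    unfolding sphere_chart_def prod.case Let_def polar ..
  then have "sphere_chart (Arg X, Y) = (z, w)"
    using z by (simp add: X_def Y_def unstraighten_straighten)
  moreover have "Y \<in> cball 0 (sqrt m)"
    using Y by (simp add: real_le_rsqrt)
  ultimately show ?thesis
    by blast
qed

lemma connected_bounded_part: "connected bounded_part"
proof -
  have "bounded_part = sphere_chart ` (UNIV \<times> cball 0 (sqrt m))"
  proof (intro equalityI subsetI)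
    fix x assume "x \<in> bounded_part"
    then show "x \<in> sphere_chart ` (UNIV \<times> cball 0 (sqrt m))"
      using sphere_chart_onto[of "fst x" "snd x"] by force
  qed (use sphere_chart_range(1) in auto)
  then show ?thesis
    using connected_continuous_image[OF continuous_on_sphere_chart]
    by (simp add: connected_Times)
qed

lemma connected_bounded_part_nonzero: "connected {x \<in> bounded_part. fst x \<noteq> 0}"
  and bounded_part_nonzero_nonempty: "{x \<in> bounded_part. fst x \<noteq> 0} \<noteq> {}"
proof -
  have eq: "{x \<in> bounded_part. fst x \<noteq> 0} = sphere_chart ` (UNIV \<times> ball 0 (sqrt m))"
  proof (intro equalityI subsetI)
    fix x assume x: "x \<in> {x \<in> bounded_part. fst x \<noteq> 0}"
    then obtain \<theta> Y where Y: "Y \<in> cball 0 (sqrt m)" "sphere_chart (\<theta>, Y) = x"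
      using sphere_chart_onto[of "fst x" "snd x"] by auto
    then have "Y \<in> ball 0 (sqrt m)"
      using x sphere_chart_range(2)[OF Y(1), of \<theta>] by auto
    then show "x \<in> sphere_chart ` (UNIV \<times> ball 0 (sqrt m))"
      using Y(2) by blast
  next
    fix x assume "x \<in> sphere_chart ` (UNIV \<times> ball 0 (sqrt m))"
    then obtain \<theta> Y where "cmod Y < sqrt m" "x = sphere_chart (\<theta>, Y)"
      by auto
    then show "x \<in> {x \<in> bounded_part. fst x \<noteq> 0}"
      using sphere_chart_range[of Y \<theta>] by auto
  qed
  have "continuous_on (UNIV \<times> ball 0 (sqrt m)) sphere_chart"
    by (rule continuous_on_subset[OF continuous_on_sphere_chart]) auto
  then show "connected {x \<in> bounded_part. fst x \<noteq> 0}"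
    unfolding eq by (intro connected_continuous_image connected_Times) (auto simp: connected_Times)
  show "{x \<in> bounded_part. fst x \<noteq> 0} \<noteq> {}"
    unfolding eq using m_pos by simp
qed

lemma bounded_part_component: "bounded_part \<in> components (regularized_hypersurface m g f)"
proof (rule connected_clopen_in_components[OF connected_bounded_part _ _ bounded_part_eq_open_box _ bounded_part_eq_closed_box])
  show "bounded_part \<noteq> {}"
    using bounded_part_nonzero_nonempty by blast
  show "open {x :: complex \<times> complex. (Re (fst x))^2 < s \<and> (Im (fst x))^2 < s}"
    by (intro open_Collect_conj open_Collect_less continuous_intros)
  show "closed {x :: complex \<times> complex. (Re (fst x))^2 \<le> p \<and> (Im (fst x))^2 \<le> p}"
    by (intro closed_Collect_conj closed_Collect_le continuous_intros)
qed

lemma bounded_well: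
  "bounded {(z, w). reg_K f g (z, w) \<le> m \<and> (Re z)^2 \<le> s \<and> (Im z)^2 \<le> s}" (is "bounded ?W")
proof -
  have "?W \<subseteq> cball 0 (sqrt (2 * p)) \<times> cball 0 (sqrt (8 * m))"
  proof clarify
    fix z w :: complex
    assume "reg_K f g (z, w) \<le> m" "(Re z)^2 \<le> s" "(Im z)^2 \<le> s"
    from in_well[OF this] have "(cmod z)^2 \<le> 2 * p" "(cmod w)^2 \<le> 8 * m"
      by (auto simp: cmod_power2)
    then show "z \<in> cball 0 (sqrt (2 * p)) \<and> w \<in> cball 0 (sqrt (8 * m))"
      by (simp add: real_le_rsqrt)
  qed
  then show ?thesis
    by (rule bounded_subset[rotated]) (intro bounded_Times bounded_cball)
qed

lemma bounded_bounded_part: "bounded bounded_part"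
  by (rule bounded_subset[OF bounded_well]) (use p in \<open>auto simp: bounded_part_def\<close>)

text \<open>Beyond \<open>s\<close> the potential decreases outwards. Moving \<open>x\<close> away from the origin therefore leaves a
nonnegative amount to be added to \<open>y\<^sup>2\<close>, and the level is kept.\<close>

lemma escape_along_plane_level:
  assumes "s \<le> x^2"
  obtains X Y where "continuous_on {0..} X" "continuous_on {0..} Y" "X 0 = x" "Y 0 = y"
    "\<And>t. t \<ge> 0 \<Longrightarrow> plane_K f g (X t, Y t) = plane_K f g (x, y)" "\<And>t. t \<ge> 0 \<Longrightarrow> t \<le> \<bar>X t\<bar>"
proof -
  define X where "X t = x + (if x \<ge> 0 then t else - t)" for t
  define Y where "Y t = (if y \<ge> 0 then 1 else -1) * sqrt (y^2 + 8 * (u (x^2) - u ((X t)^2)))" for t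
  have X: "\<bar>X t\<bar> = \<bar>x\<bar> + t" if "t \<ge> 0" for t
    using that by (simp add: X_def)
  have le: "u ((X t)^2) \<le> u (x^2)" if "t \<ge> 0" for t
    using assms X[OF that] that by (intro u_antimono) (auto simp flip: abs_le_square_iff)
  show thesis
  proof
    show cX: "continuous_on {0..} X"
      unfolding X_def by (cases "x \<ge> 0") (auto intro!: continuous_intros)
    show "continuous_on {0..} Y"
      unfolding Y_def by (intro continuous_intros cX)
    show "X 0 = x" "Y 0 = y"
      by (auto simp: X_def Y_def)
    show "plane_K f g (X t, Y t) = plane_K f g (x, y)" if "t \<ge> 0" for t
    proof -
      have "(Y t)^2 = y^2 + 8 * (u (x^2) - u ((X t)^2))"
        unfolding Y_def using le[OF that] by (simp add: power_mult_distrib)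
      then show ?thesis
        by (simp add: plane_K_u field_simps)
    qed
    show "t \<le> \<bar>X t\<bar>" if "t \<ge> 0" for t
      using X[OF that] by simp
  qed
qed

lemma escape_from_bounded_part:
  assumes K: "(z, w) \<in> regularized_hypersurface m g f" and "(z, w) \<notin> bounded_part"
  obtains T where "connected T" "T \<subseteq> regularized_hypersurface m g f" "(z, w) \<in> T" "\<not> bounded T"
proof -
  note escape = that
  have ray: thesis
    if "continuous_on {0..} \<gamma>" "\<And>t. t \<ge> 0 \<Longrightarrow> \<gamma> t \<in> regularized_hypersurface m g f"
      "\<gamma> 0 = (z, w)" "\<And>t. t \<ge> 0 \<Longrightarrow> t \<le> norm (\<gamma> t)" for \<gamma> :: "real \<Rightarrow> complex \<times> complex"
  proof (rule escape)
    show "connected (\<gamma> ` {0..})"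
      using that(1) by (rule connected_continuous_image) simp
    show "\<not> bounded (\<gamma> ` {0..})"
      using that(4) by (intro unbounded_image_of_ray[of 0 1]) auto
    show "(z, w) \<in> \<gamma> ` {0..}"
      using that(3) by (auto intro!: rev_image_eqI[of 0])
  qed (use that in auto)
  \<comment> \<open>One plane is beyond the top of the well; the path moves in that plane and rests in the other.\<close>
  from assms have "s \<le> (Re z)^2 \<or> s \<le> (Im z)^2"
    using bounded_part_eq_open_box by auto
  then show thesis
  proof
    assume "s \<le> (Re z)^2"
    then obtain X Y where XY: "continuous_on {0..} X" "continuous_on {0..} Y"
      "X 0 = Re z" "Y 0 = Re w"
      "\<And>t. t \<ge> 0 \<Longrightarrow> plane_K f g (X t, Y t) = plane_K f g (Re z, Re w)" "\<And>t. t \<ge> 0 \<Longrightarrow> t \<le> \<bar>X t\<bar>"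
      using escape_along_plane_level by metis
    show thesis
    proof (rule ray[of "\<lambda>t. (Complex (X t) (Im z), Complex (Y t) (Im w))"])
      show "t \<le> norm (Complex (X t) (Im z), Complex (Y t) (Im w))" if "t \<ge> 0" for t
        using XY(6)[OF that] abs_Re_le_cmod[of "Complex (X t) (Im z)"]
          norm_fst_le[of "Complex (X t) (Im z)" "Complex (Y t) (Im w)"] by simp
    qed (use K XY in \<open>auto intro!: continuous_intros simp: regularized_hypersurface_def reg_K_split\<close>)
  next
    assume "s \<le> (Im z)^2"
    then obtain X Y where XY: "continuous_on {0..} X" "continuous_on {0..} Y"
      "X 0 = Im z" "Y 0 = Im w"
      "\<And>t. t \<ge> 0 \<Longrightarrow> plane_K f g (X t, Y t) = plane_K f g (Im z, Im w)" "\<And>t. t \<ge> 0 \<Longrightarrow> t \<le> \<bar>X t\<bar>"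
      using escape_along_plane_level by metis
    show thesis
    proof (rule ray[of "\<lambda>t. (Complex (Re z) (X t), Complex (Re w) (Y t))"])
      show "t \<le> norm (Complex (Re z) (X t), Complex (Re w) (Y t))" if "t \<ge> 0" for t
        using XY(6)[OF that] abs_Im_le_cmod[of "Complex (Re z) (X t)"]
          norm_fst_le[of "Complex (Re z) (X t)" "Complex (Re w) (Y t)"] by simp
    qed (use K XY in \<open>auto intro!: continuous_intros simp: regularized_hypersurface_def reg_K_split\<close>)
  qed
qed

lemma bounded_component_iff:
  "C \<in> components (regularized_hypersurface m g f) \<and> bounded C \<longleftrightarrow> C = bounded_part"
proof
  assume C: "C \<in> components (regularized_hypersurface m g f) \<and> bounded C"
  have "x \<in> bounded_part" if "x \<in> C" for x
  proof (rule ccontr)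
    assume "x \<notin> bounded_part"
    moreover have "x \<in> regularized_hypersurface m g f"
      using in_components_subset[of C] C that by auto
    ultimately obtain T where T: "connected T" "T \<subseteq> regularized_hypersurface m g f" "x \<in> T" "\<not> bounded T"
      using escape_from_bounded_part[of "fst x" "snd x"] by auto
    then have "T \<subseteq> C"
      using components_maximal[of C _ T] C that by auto
    then have "bounded T"
      using C by (blast intro: bounded_subset)
    with T(4) show False ..
  qed
  moreover have "C \<noteq> {}"
    using in_components_nonempty C by blast
  ultimately have "C \<inter> bounded_part \<noteq> {}"
    by blast
  then show "C = bounded_part"
    using components_eq[of C _ bounded_part] C bounded_part_component by auto
qed (simp add: bounded_part_component bounded_bounded_part)

lemma origin_inside_bounded_part: "0 \<in> inside bounded_part"
proof -
  define D where "D = {x. reg_K f g (fst x, snd x) < m \<and> (Re (fst x))^2 < s \<and> (Im (fst x))^2 < s}"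
  define W where "W = {x. reg_K f g (fst x, snd x) \<le> m \<and> (Re (fst x))^2 \<le> s \<and> (Im (fst x))^2 \<le> s}"
  have "open D"
    unfolding D_def reg_K_u
    by (intro open_Collect_conj open_Collect_less continuous_intros) auto
  have "closed W"
    unfolding W_def reg_K_u
    by (intro closed_Collect_conj closed_Collect_le continuous_intros) auto
  then have "closure D \<subseteq> W"
    by (intro closure_minimal) (auto simp: D_def W_def)
  moreover have "W - D \<subseteq> bounded_part"
  proof
    fix x assume x: "x \<in> W - D"
    then have "(Re (fst x))^2 \<le> p" "(Im (fst x))^2 \<le> p"
      using in_well[of "fst x" "snd x"] by (auto simp: W_def)
    then show "x \<in> bounded_part"
      using x p by (cases x) (auto simp: W_def D_def bounded_part_def)
  qed
  ultimately have "frontier D \<subseteq> bounded_part"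
    using \<open>open D\<close> by (auto simp: frontier_def interior_open)
  moreover have "bounded D"
    by (rule bounded_subset[OF bounded_well]) (auto simp: D_def)
  moreover have "D \<inter> bounded_part = {}"
    by (auto simp: D_def bounded_part_def)
  ultimately have "D \<subseteq> inside bounded_part"
    using \<open>open D\<close> by (intro open_bounded_subset_inside)
  moreover have "0 \<in> D"
    using m_pos p by (simp add: D_def reg_K_def zero_prod_def)
  ultimately show ?thesis
    by blast
qed

text \<open>For a point of either plane on the level \<open>a \<le> m\<close>, the point \<open>(0, sqrt (8 (m - a)))\<close> of the other plane completes
it to a point of the bounded part.\<close>

lemma level_eq:
  assumes "a \<in> {0..m}"
  shows "level1 f g bounded_part a = {(x, y). x^2 \<le> p \<and> plane_K f g (x, y) = a}"
    and "level2 f g bounded_part a = {(x, y). x^2 \<le> p \<and> plane_K f g (x, y) = a}"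
proof -
  have compl: "plane_K f g (0, sqrt (8 * (m - a))) = m - a"
    using assms by (simp add: plane_K_u)
  show "level1 f g bounded_part a = {(x, y). x^2 \<le> p \<and> plane_K f g (x, y) = a}"
  proof (intro equalityI subsetI)
    fix v assume "v \<in> {(x, y). x^2 \<le> p \<and> plane_K f g (x, y) = a}"
    then obtain x y where v: "v = (x, y)" "x^2 \<le> p" "plane_K f g (x, y) = a"
      by auto
    then have "(Complex x 0, Complex y (sqrt (8 * (m - a)))) \<in> bounded_part"
      using compl p by (simp add: bounded_part_def reg_K_split)
    then show "v \<in> level1 f g bounded_part a"
      unfolding level1_def using v
      by (intro CollectI exI[of _ "Complex x 0"] exI[of _ "Complex y (sqrt (8 * (m - a)))"]) simp
  qed (auto simp: level1_def bounded_part_def)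
  show "level2 f g bounded_part a = {(x, y). x^2 \<le> p \<and> plane_K f g (x, y) = a}"
  proof (intro equalityI subsetI)
    fix v assume "v \<in> {(x, y). x^2 \<le> p \<and> plane_K f g (x, y) = a}"
    then obtain x y where v: "v = (x, y)" "x^2 \<le> p" "plane_K f g (x, y) = a"
      by auto
    then have "(Complex 0 x, Complex (sqrt (8 * (m - a))) y) \<in> bounded_part"
      using compl p by (simp add: bounded_part_def reg_K_split)
    then show "v \<in> level2 f g bounded_part a"
      unfolding level2_def using v
      by (intro CollectI exI[of _ "Complex 0 x"] exI[of _ "Complex (sqrt (8 * (m - a))) y"]) simp
  qed (auto simp: level2_def bounded_part_def)
qed

text \<open>Along a ray from the origin the value of \<open>plane_K\<close> grows as long as the ray stays in the well. A ray that
starts outside the region therefore never returns to the level, and it leads to infinity.\<close>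

lemma inside_level:
  assumes a: "a \<in> {0..m}"
  shows "inside {(x, y). x^2 \<le> p \<and> plane_K f g (x, y) = a} = {(x, y). x^2 < s \<and> plane_K f g (x, y) < a}"
    (is "inside ?S = ?D")
proof
  have in_p: "x^2 \<le> p" if "x^2 \<le> s" "plane_K f g (x, y) \<le> a" for x y
  proof (rule ccontr)
    assume "\<not> x^2 \<le> p"
    then have "m < u (x^2)"
      using u_less[of p "x^2"] that(1) p by simp
    then show False
      using that(2) a zero_le_power2[of y] unfolding plane_K_u atLeastAtMost_iff by linarith
  qed
  show "?D \<subseteq> inside ?S"
  proof (rule open_bounded_subset_inside)
    have D: "?D = {v. (fst v)^2 < s \<and> (snd v)^2 / 8 + u ((fst v)^2) < a}"
      by (auto simp: plane_K_u)
    show "open ?D"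
      unfolding D by (intro open_Collect_conj open_Collect_less continuous_intros) auto
    have "closed {v :: real \<times> real. (fst v)^2 \<le> s \<and> (snd v)^2 / 8 + u ((fst v)^2) \<le> a}"
      by (intro closed_Collect_conj closed_Collect_le continuous_intros) auto
    then have "closure ?D \<subseteq> {v. (fst v)^2 \<le> s \<and> (snd v)^2 / 8 + u ((fst v)^2) \<le> a}"
      unfolding D by (intro closure_minimal) auto
    then have cl: "closure ?D \<subseteq> {(x, y). x^2 \<le> s \<and> plane_K f g (x, y) \<le> a}"
      by (auto simp: plane_K_u)
    have "{(x, y). x^2 \<le> s \<and> plane_K f g (x, y) \<le> a} - ?D \<subseteq> ?S"
      using in_p p by fastforce
    then show "frontier ?D \<subseteq> ?S"
      using cl \<open>open ?D\<close> by (auto simp only: frontier_def interior_open)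
    have "?D \<subseteq> cball 0 (sqrt p) \<times> cball 0 (sqrt (8 * a))"
    proof clarify
      fix x y assume *: "x^2 < s" "plane_K f g (x, y) < a"
      then have "x^2 \<le> p" "y^2 \<le> 8 * a"
        using in_p[of x y] u_le[of 0 "x^2"] by (auto simp: plane_K_u)
      then show "x \<in> cball 0 (sqrt p) \<and> y \<in> cball 0 (sqrt (8 * a))"
        by (simp add: real_le_rsqrt)
    qed
    then show "bounded ?D"
      by (rule bounded_subset[rotated]) (intro bounded_Times bounded_cball)
    show "?D \<inter> ?S = {}"
      by auto
  qed
  show "inside ?S \<subseteq> ?D"
  proof (rule ccontr)
    assume "\<not> inside ?S \<subseteq> ?D"
    then obtain x y where xy: "(x, y) \<in> inside ?S" "(x, y) \<notin> ?D"
      by auto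
    then have notS: "(x, y) \<notin> ?S"
      by (auto simp: inside_def)
    let ?T = "(\<lambda>t. t *\<^sub>R (x, y)) ` {1..}"
    have "(x, y) \<noteq> 0"
      using xy(2) notS a p by (auto simp: plane_K_u zero_prod_def)
    moreover have "norm (x, y) * t \<le> norm (t *\<^sub>R (x, y))" if "t \<ge> 1" for t
      unfolding norm_scaleR using that by simp
    ultimately have "\<not> bounded ?T"
      by (intro unbounded_image_of_ray[where k = "norm (x, y)"]) auto
    moreover have "connected ?T"
      by (intro connected_continuous_image continuous_intros) auto
    moreover have "?T \<inter> ?S = {}"
    proof -
      have False if t: "t \<ge> 1" "(t * x)^2 \<le> p" "plane_K f g (t * x, t * y) = a" for t
      proof -
        have "\<bar>x\<bar> \<le> \<bar>t * x\<bar>" "\<bar>y\<bar> \<le> \<bar>t * y\<bar>"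
          using t(1) by (auto simp: abs_mult mult_le_cancel_right1)
        then have le: "x^2 \<le> (t * x)^2" "y^2 \<le> (t * y)^2"
          by (simp_all add: abs_le_square_iff)
        then have "plane_K f g (x, y) \<le> a"
          using u_le[of "x^2" "(t * x)^2"] t p unfolding plane_K_u by simp
        then show False
          using le t(2) p xy(2) notS by auto
      qed
      then show ?thesis by auto
    qed
    moreover have "(x, y) \<in> ?T"
      by (auto intro!: rev_image_eqI[of 1])
    ultimately show False
      using not_inside_if_escapes xy(1) by blast
  qed
qed

lemma bounds_concave: "bounds_concave_toric_domain m g f bounded_part"
proof -
  have act: "action (level1 f g bounded_part a) = well_action a" "action (level2 f g bounded_part a) = well_action a"
    if "a \<in> {0..m}" for a
    using that by (simp_all add: action_def level_eq inside_level area_between_levels)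
  have "moment_curve m g f bounded_part = (\<lambda>a. (well_action a, well_action (m - a))) ` {0..m}"
    unfolding moment_curve_def by (intro image_cong) (auto simp: act)
  moreover have "0 < well_action m"
    using strict_mono_onD[OF strict_mono_on_well_action, of 0 m] m_pos by simp
  ultimately show ?thesis
    unfolding bounds_concave_toric_domain_def action_graph
    using smooth_within_\<phi> antimono_on_\<phi> convex_on_\<phi> by blast
qed

text \<open>The image of the bounded part. By \<open>cmod_square_plus_Re\<close> the condition on the position says
\<open>(Re z)\<^sup>2 \<le> p\<close> and \<open>(Im z)\<^sup>2 \<le> p\<close> for a square root \<open>z\<close> of it.\<close>

definition energy_part :: "(complex \<times> complex) set" where
  "energy_part = energy_hypersurface m g f \<inter> {x. cmod (fst x) + \<bar>Re (fst x)\<bar> \<le> 2 * p}"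

lemma levi_civita_in_energy_part_iff: "z \<noteq> 0 \<Longrightarrow> levi_civita (z, w) \<in> energy_part \<longleftrightarrow> (z, w) \<in> bounded_part"
  by (auto simp: energy_part_def bounded_part_def levi_civita_in_energy_hypersurface_iff fst_levi_civita cmod_square_plus_Re)

lemma energy_part_eq_image: "energy_part = levi_civita ` {x \<in> bounded_part. fst x \<noteq> 0}"
proof (intro equalityI subsetI)
  fix x assume x: "x \<in> energy_part"
  then obtain z w where "z \<noteq> 0" "levi_civita (z, w) = x"
    using levi_civita_surj[of "fst x" "snd x"] by (auto simp: energy_part_def energy_hypersurface_def)
  then show "x \<in> levi_civita ` {x \<in> bounded_part. fst x \<noteq> 0}"
    using x levi_civita_in_energy_part_iff by force
qed (auto simp: levi_civita_in_energy_part_iff)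

lemma energy_part_eq_open: "energy_part = energy_hypersurface m g f \<inter> {x. cmod (fst x) + \<bar>Re (fst x)\<bar> < 2 * s}"
proof -
  have "x \<in> energy_part" if x: "x \<in> energy_hypersurface m g f" "cmod (fst x) + \<bar>Re (fst x)\<bar> < 2 * s" for x
  proof -
    obtain z w where z: "z \<noteq> 0" "levi_civita (z, w) = x"
      using levi_civita_surj[of "fst x" "snd x"] x(1) by (auto simp: energy_hypersurface_def)
    then have "reg_K f g (z, w) = m" "(Re z)^2 < s" "(Im z)^2 < s"
      using x levi_civita_in_energy_hypersurface_iff[of z w] cmod_square_plus_Re[of z]
      by (auto simp: levi_civita_def)
    then have "(z, w) \<in> bounded_part"
      using bounded_part_eq_open_box by (auto simp: regularized_hypersurface_def)
    then show ?thesis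
      using z levi_civita_in_energy_part_iff by blast
  qed
  then show ?thesis
    using p by (auto simp: energy_part_def)
qed

lemma energy_part_component: "energy_part \<in> components (energy_hypersurface m g f)"
proof (rule connected_clopen_in_components[OF _ _ _ energy_part_eq_open _ energy_part_def])
  have "continuous_on {x \<in> bounded_part. fst x \<noteq> 0} levi_civita"
    unfolding levi_civita_def split_beta by (intro continuous_intros) auto
  then show "connected energy_part"
    unfolding energy_part_eq_image using connected_bounded_part_nonzero by (rule connected_continuous_image)
  show "energy_part \<noteq> {}"
    unfolding energy_part_eq_image using bounded_part_nonzero_nonempty by blast
  show "open {x :: complex \<times> complex. cmod (fst x) + \<bar>Re (fst x)\<bar> < 2 * s}"
    by (intro open_Collect_less continuous_intros)
  show "closed {x :: complex \<times> complex. cmod (fst x) + \<bar>Re (fst x)\<bar> \<le> 2 * p}"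
    by (intro closed_Collect_le continuous_intros)
qed

lemma bounded_energy_part: "bounded (fst ` energy_part)"
  by (rule bounded_subset[OF bounded_cball[of 0 "2 * p"]]) (auto simp: energy_part_def)

end

section \<open>Critical values and the energy condition\<close>

lemma has_derivative_hill_V:
  assumes "q \<noteq> 0"
  shows "(hill_V m g has_derivative (\<lambda>h. Re h * (Re q * (m / (cmod q)^3 - 2 * g))
           + Im h * (Im q * (m / (cmod q)^3 - g / 2)))) (at q)"
proof -
  have "((\<lambda>q. - m / cmod q - g * (Re q)^2 - g * ((Im q)^2 / 4)) has_derivative
     (\<lambda>h. m * (h \<bullet> sgn q) / (cmod q)^2 - g * (2 * Re q * Re h) - g * (2 * Im q * Im h / 4))) (at q)"
    using assms
    by (auto intro!: derivative_eq_intros has_derivative_norm ext simp: power2_eq_square field_simps)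
  then show ?thesis
    unfolding hill_V_def
    by (rule has_derivative_eq_rhs)
       (use assms in \<open>auto simp: sgn_div_norm inner_complex_def power2_eq_square power3_eq_cube field_simps\<close>)
qed

text \<open>Away from the axes the two components of the gradient would force \<open>\<bar>q\<bar>\<^sup>3\<close> to be both \<open>m / (2 g)\<close> and
\<open>2 m / g\<close>, which differ as \<open>m > 0\<close>.\<close>

lemma critical_point_hill_V_iff:
  assumes "q \<noteq> 0" "m > 0" "g > 0"
  shows "(hill_V m g has_derivative (\<lambda>_. 0)) (at q) \<longleftrightarrow>
     Im q = 0 \<and> \<bar>Re q\<bar> ^ 3 = m / (2 * g) \<or> Re q = 0 \<and> \<bar>Im q\<bar> ^ 3 = 2 * m / g"
proof -
  let ?d = "\<lambda>h. Re h * (Re q * (m / (cmod q)^3 - 2 * g)) + Im h * (Im q * (m / (cmod q)^3 - g / 2))"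
  have "(hill_V m g has_derivative (\<lambda>_. 0)) (at q) \<longleftrightarrow> ?d = (\<lambda>_. 0)"
  proof
    show "?d = (\<lambda>_. 0)" if "(hill_V m g has_derivative (\<lambda>_. 0)) (at q)"
      using has_derivative_hill_V[OF assms(1)] that by (rule has_derivative_unique)
    show "(hill_V m g has_derivative (\<lambda>_. 0)) (at q)" if "?d = (\<lambda>_. 0)"
      using has_derivative_hill_V[OF assms(1), of m g] unfolding that .
  qed
  also have "\<dots> \<longleftrightarrow> Re q * (m / (cmod q)^3 - 2 * g) = 0 \<and> Im q * (m / (cmod q)^3 - g / 2) = 0"
  proof
    assume d: "?d = (\<lambda>_. 0)"
    show "Re q * (m / (cmod q)^3 - 2 * g) = 0 \<and> Im q * (m / (cmod q)^3 - g / 2) = 0"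
      using fun_cong[OF d, of 1] fun_cong[OF d, of \<i>] by simp
  qed auto
  also have "\<dots> \<longleftrightarrow> (Re q = 0 \<or> (cmod q)^3 = m / (2 * g)) \<and> (Im q = 0 \<or> (cmod q)^3 = 2 * m / g)"
    using assms by (auto simp: field_simps)
  also have "\<dots> \<longleftrightarrow> Im q = 0 \<and> (cmod q)^3 = m / (2 * g) \<or> Re q = 0 \<and> (cmod q)^3 = 2 * m / g"
    using assms by (auto simp: complex_eq_iff field_simps)
  also have "\<dots> \<longleftrightarrow> Im q = 0 \<and> \<bar>Re q\<bar> ^ 3 = m / (2 * g) \<or> Re q = 0 \<and> \<bar>Im q\<bar> ^ 3 = 2 * m / g"
    by (auto simp: cmod_eq_Re cmod_eq_Im)
  finally show ?thesis .
qed

text \<open>\<open>\<rho>\<close> and \<open>\<tau>\<close> are the distances of the critical points on the first and on the second axis. From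
\<open>\<tau>\<^sup>3 = 4 \<rho>\<^sup>3 < (2 \<rho>)\<^sup>3\<close> the critical value on the first axis is the lower one.\<close>

lemma hill_critical_values:
  assumes "m > 0" "g > 0"
  obtains \<rho> \<tau> where "\<rho> > 0" "2 * g * \<rho>^3 = m" "- 3 * g * \<rho>^2 < - (3 / 4) * g * \<tau>^2"
    "critical_values (hill_V m g) = {- 3 * g * \<rho>^2, - (3 / 4) * g * \<tau>^2}"
proof -
  define \<rho> where "\<rho> = root 3 (m / (2 * g))"
  define \<tau> where "\<tau> = root 3 (2 * m / g)"
  have pos: "\<rho> > 0" "\<tau> > 0"
    using assms by (simp_all add: \<rho>_def \<tau>_def)
  have cubes: "\<rho>^3 = m / (2 * g)" "\<tau>^3 = 2 * m / g"
    using assms by (simp_all add: \<rho>_def \<tau>_def)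
  then have m: "m = 2 * g * \<rho>^3" "m = g / 2 * \<tau>^3"
    using assms by (simp_all add: field_simps)
  have V1: "hill_V m g q = - 3 * g * \<rho>^2" if "Im q = 0" "\<bar>Re q\<bar> = \<rho>" for q
    unfolding hill_V_def using that pos power2_abs[of "Re q"]
    by (subst m(1)) (simp add: cmod_eq_Re power2_eq_square power3_eq_cube)
  have V2: "hill_V m g q = - (3 / 4) * g * \<tau>^2" if "Re q = 0" "\<bar>Im q\<bar> = \<tau>" for q
    unfolding hill_V_def using that pos power2_abs[of "Im q"]
    by (subst m(2)) (simp add: cmod_eq_Im power2_eq_square power3_eq_cube)
  have cube_eq: "\<bar>x\<bar>^3 = y^3 \<longleftrightarrow> \<bar>x\<bar> = y" if "y > 0" for x y :: real
    using that by (simp add: power_eq_iff_eq_base)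
  have "critical_values (hill_V m g)
      = {hill_V m g q | q. q \<noteq> 0 \<and> (Im q = 0 \<and> \<bar>Re q\<bar> = \<rho> \<or> Re q = 0 \<and> \<bar>Im q\<bar> = \<tau>)}"
    unfolding critical_values_def cube_eq[OF pos(1), symmetric] cube_eq[OF pos(2), symmetric] cubes
    using critical_point_hill_V_iff[OF _ assms] by blast
  also have "\<dots> = {- 3 * g * \<rho>^2, - (3 / 4) * g * \<tau>^2}"
  proof (intro equalityI subsetI)
    fix v assume "v \<in> {- 3 * g * \<rho>^2, - (3 / 4) * g * \<tau>^2}"
    then have "v = hill_V m g (of_real \<rho>) \<or> v = hill_V m g (\<i> * of_real \<tau>)"
      using V1[of "of_real \<rho>"] V2[of "\<i> * of_real \<tau>"] pos by auto
    then show "v \<in> {hill_V m g q | q. q \<noteq> 0 \<and> (Im q = 0 \<and> \<bar>Re q\<bar> = \<rho> \<or> Re q = 0 \<and> \<bar>Im q\<bar> = \<tau>)}"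
    proof
      assume "v = hill_V m g (of_real \<rho>)"
      then show ?thesis
        using pos by (intro CollectI exI[of _ "of_real \<rho>"]) auto
    next
      assume "v = hill_V m g (\<i> * of_real \<tau>)"
      then show ?thesis
        using pos by (intro CollectI exI[of _ "\<i> * of_real \<tau>"]) auto
    qed
  qed (use V1 V2 in blast)
  finally have crit: "critical_values (hill_V m g) = {- 3 * g * \<rho>^2, - (3 / 4) * g * \<tau>^2}" .
  have "\<tau>^3 < (2 * \<rho>)^3"
    using assms by (simp add: cubes power_mult_distrib field_simps)
  then have "\<tau> < 2 * \<rho>"
    by (rule power_less_imp_less_base) (use pos in simp)
  then have "\<tau>^2 < (2 * \<rho>)^2"
    using pos by (intro power_strict_mono) auto
  then have "g * \<tau>^2 < g * (4 * \<rho>^2)"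
    using assms by (simp add: power_mult_distrib)
  then show thesis
    using that[OF pos(1) m(1)[symmetric] _ crit] by simp
qed

text \<open>The hypothesis on the energy says \<open>f > 3 g \<rho>\<^sup>2\<close>. It gives both \<open>\<rho> < s\<close> and
\<open>f \<rho> - g \<rho>\<^sup>3 > 2 g \<rho>\<^sup>3 = m\<close>, so the level \<open>m\<close> is reached before \<open>\<rho>\<close>.\<close>

lemma hill_well_below_first_critical_value:
  fixes m g f :: real
  assumes "m > 0" "g > 0" and f: "- f < first_critical_value (hill_V m g)"
  obtains s p where "hill_well m g f s p"
proof -
  obtain \<rho> \<tau> where \<rho>: "\<rho> > 0" "2 * g * \<rho>^3 = m" and less: "- 3 * g * \<rho>^2 < - (3 / 4) * g * \<tau>^2"
    and crit: "critical_values (hill_V m g) = {- 3 * g * \<rho>^2, - (3 / 4) * g * \<tau>^2}"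
    using hill_critical_values[OF assms(1,2)] .
  have "first_critical_value (hill_V m g) = - 3 * g * \<rho>^2"
    unfolding first_critical_value_def crit using less by (simp add: min_def)
  with f have f\<rho>: "3 * g * \<rho>^2 < f"
    by simp
  then have "3 * g * \<rho>^2 * \<rho> < f * \<rho>"
    using \<rho>(1) by (rule mult_strict_right_mono)
  then have "m < f * \<rho> - g * \<rho>^3"
    using \<rho>(2) by (simp add: power2_eq_square power3_eq_cube)
  then have "\<exists>p. 0 \<le> p \<and> p \<le> \<rho> \<and> f * p - g * p^3 = m"
    using \<rho>(1) assms by (intro IVT') (auto intro!: continuous_intros)
  then obtain p where p: "0 \<le> p" "p \<le> \<rho>" "f * p - g * p^3 = m"
    by blast
  define s where "s = sqrt (f / (3 * g))"
  have "\<rho>^2 < f / (3 * g)"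
    using f\<rho> assms by (simp add: field_simps)
  then have "\<rho> < s" 
    unfolding s_def by (rule real_less_rsqrt)
  moreover have "f = 3 * g * s^2"
    using f\<rho> assms \<rho>(1) order_trans[of 0 "3 * g * \<rho>^2" f] by (simp add: s_def)
  moreover have "p \<noteq> 0"
    using p(3) assms by auto
  ultimately have "hill_well m g f s p"
    using p assms by unfold_locales auto
  then show thesis ..
qed

section \<open>The concave toric domain\<close>

theorem theorem1:
  fixes m g f :: real
  assumes "m > 0" and "g > 0"
    and "- f < first_critical_value (hill_V m g)"
  shows "card (critical_values (hill_V m g)) = 2 \<and>
    (\<forall>z w. z \<noteq> 0 \<longrightarrow>
       (cmod z)^2 * (hill_H m g (levi_civita (z, w)) + f) = reg_K f g (z, w) - m) \<and>
    (\<exists>!C. C \<in> components (regularized_hypersurface m g f) \<and> bounded C) \<and>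
    (\<forall>C. C \<in> components (regularized_hypersurface m g f) \<and> bounded C \<longrightarrow>
       (\<exists>E \<in> components (energy_hypersurface m g f). bounded (fst ` E) \<and>
          {x \<in> C. fst x \<noteq> 0} = {x. fst x \<noteq> 0 \<and> levi_civita x \<in> E}) \<and>
       0 \<in> inside C \<and>
       bounds_concave_toric_domain m g f C)"
proof -
  obtain s p where "hill_well m g f s p"
    using hill_well_below_first_critical_value[OF assms] .
  then interpret hill_well m g f s p .
  have "card (critical_values (hill_V m g)) = 2"
  proof (rule hill_critical_values[OF assms(1,2)])
    fix \<rho> \<tau> :: real
    assume "- 3 * g * \<rho>^2 < - (3 / 4) * g * \<tau>^2"
      and crit: "critical_values (hill_V m g) = {- 3 * g * \<rho>^2, - (3 / 4) * g * \<tau>^2}"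
    then have "- 3 * g * \<rho>^2 \<noteq> - (3 / 4) * g * \<tau>^2"
      by linarith
    then show ?thesis
      unfolding crit card_2_iff by blast
  qed
  moreover have "{x \<in> bounded_part. fst x \<noteq> 0} = {x. fst x \<noteq> 0 \<and> levi_civita x \<in> energy_part}"
    using levi_civita_in_energy_part_iff by auto
  ultimately show ?thesis
    using levi_civita_pullback energy_part_component bounded_energy_part origin_inside_bounded_part bounds_concave
    unfolding bounded_component_iff by blast
qed

end
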